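(* Let $d\ge 2$, let $n=\binom{d}{2}$, and let $A\in\mathbb{Z}^{d\times n}$ be the vertex–arc incidence matrix of the acyclic tournament graph $G_d$. As $\mathbf{c}$ ranges over all generic cost vectors in $\mathbb{R}^n$, the maximum of the arithmetic degree of $in_{\mathbf{c}}(I_A)$ equals the $(d-1)$-th Catalan number $C_{d-1}=\frac{1}{d}\binom{2(d-1)}{d-1}$.
   Context: $G_d$ is the directed graph on vertices $1,\dots,d$ with the $n=\binom d2$ arcs $(i,j)$, $1\le i<j\le d$, each directed from $i$ to $j$. Its vertex–arc incidence matrix $A$ has rows indexed by vertices and columns by arcs, the column of arc $(i,j)$ having entry $1$ in row $i$, $-1$ in row $j$ and $0$ elsewhere. Work in $k[\mathbf{x}]=k[x_{i,j}:1\le i<j\le d]$ over a field $k$. The toric ideal is $I_A=\langle \mathbf{x}^{\mathbf{u}}-\mathbf{x}^{\mathbf{v}} : A\mathbf{u}=A\mathbf{v},\ \mathbf{u},\mathbf{v}\in\mathbb{N}^n\rangle$. A cost vector $\mathbf{c}\in\mathbb{R}^n$ is generic if for every $\mathbf{b}\in\{A\mathbf{u}:\mathbf{u}\in\mathbb{N}^n\}$ the program $\min\{\mathbf{c}\cdot\mathbf{x}: A\mathbf{x}=\mathbf{b},\ \mathbf{x}\in\mathbb{N}^n\}$ has a unique optimal solution; then $in_{\mathbf{c}}(I_A)$, the ideal generated by the $\mathbf{c}$-largest terms of elements of $I_A$, is a monomial ideal. For a monomial ideal $J\subseteq k[x_1,\dots,x_n]$, a standard pair is a pair $(\mathbf{x}^{\mathbf{a}},\sigma)$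 with $\sigma\subseteq[n]$ such that (i) $\mathrm{supp}(\mathbf{a})\cap\sigma=\emptyset$; (ii) no monomial $\mathbf{x}^{\mathbf{a}}\mathbf{x}^{\mathbf{w}}$ with $\mathrm{supp}(\mathbf{w})\subseteq\sigma$ lies in $J$; (iii) there is no other pair $(\mathbf{x}^{\mathbf{a}'},\sigma')$ satisfying (i),(ii) with $\mathbf{x}^{\mathbf{a}'}$ dividing $\mathbf{x}^{\mathbf{a}}$ and $\mathrm{supp}(\mathbf{x}^{\mathbf{a}}/\mathbf{x}^{\mathbf{a}'})\cup\sigma\subseteq\sigma'$. The arithmetic degree of $J$ is the number of its standard pairs. *)

theory Defs
  imports
    Complex_Main
    "HOL-Library.FuncSet"
    "HOL-Library.Poly_Mapping"
    "HOL-Library.Extended_Nat"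
    "HOL-Algebra.Ideal"
begin

section \<open>Polynomial rings and monomials\<close>

text \<open>
  Exponent vectors are finitely supported functions to the naturals, and polynomials are
  finitely supported functions from exponent vectors to the coefficients.  The set of variables
  is an explicit parameter \<open>V\<close>, so that the number of variables can depend on a natural number.
\<close>

type_synonym 'v expo = "'v \<Rightarrow>\<^sub>0 nat"
type_synonym ('v, 'k) mpoly = "'v expo \<Rightarrow>\<^sub>0 'k"

definition expos :: "'v set \<Rightarrow> 'v expo set" where
  "expos V = {u. Poly_Mapping.keys u \<subseteq> V}"

definition mpoly_ring :: "'v set \<Rightarrow> ('v, 'k::field) mpoly ring" where
  "mpoly_ring V = \<lparr>carrier = {p. Poly_Mapping.keys p \<subseteq> expos V},
                   monoid.mult = (*), one = 1, zero = 0, add = (+)\<rparr>"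

definition xpow :: "'v expo \<Rightarrow> ('v, 'k::field) mpoly" where
  "xpow u = Poly_Mapping.single u 1"

lemma expos_plus: "u \<in> expos V \<Longrightarrow> v \<in> expos V \<Longrightarrow> u + v \<in> expos V"
  unfolding expos_def using Poly_Mapping.keys_add[of u v] by blast

lemma cring_mpoly_ring: "cring (mpoly_ring V :: ('v, 'k::field) mpoly ring)"
proof -
  let ?P = "{p :: ('v, 'k) mpoly. Poly_Mapping.keys p \<subseteq> expos V}"
  have add: "p + q \<in> ?P" if "p \<in> ?P" "q \<in> ?P" for p q
    using that Poly_Mapping.keys_add[of p q] by blast
  have mult: "p * q \<in> ?P" if "p \<in> ?P" "q \<in> ?P" for p q
    using that Poly_Mapping.keys_mult[of p q] expos_plus[where V = V] by blast
  have one: "(1 :: ('v, 'k) mpoly) \<in> ?P"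
    by (simp add: expos_def)
  have uminus: "- p \<in> ?P" if "p \<in> ?P" for p
    using that by simp
  show ?thesis
  proof (rule cringI)
    show "abelian_group (mpoly_ring V :: ('v, 'k) mpoly ring)"
    proof (rule abelian_groupI)
      fix x :: "('v, 'k) mpoly"
      assume "x \<in> carrier (mpoly_ring V)"
      thus "\<exists>y \<in> carrier (mpoly_ring V). y \<oplus>\<^bsub>mpoly_ring V\<^esub> x = \<zero>\<^bsub>mpoly_ring V\<^esub>"
        using uminus by (intro bexI[of _ "- x"]) (auto simp: mpoly_ring_def)
    qed (use add in \<open>auto simp: mpoly_ring_def algebra_simps\<close>)
    show "Group.comm_monoid (mpoly_ring V :: ('v, 'k) mpoly ring)"
      by (rule comm_monoidI)
         (use mult one in \<open>auto simp: mpoly_ring_def algebra_simps\<close>)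
  qed (auto simp: mpoly_ring_def algebra_simps)
qed

section \<open>Initial ideals with respect to a cost vector\<close>

text \<open>
  A cost vector is a function on the variables; only its values on \<open>V\<close> ever matter.
\<close>

definition cost :: "('v \<Rightarrow> real) \<Rightarrow> 'v expo \<Rightarrow> real" where
  "cost c u = (\<Sum>e\<in>Poly_Mapping.keys u. c e * real (Poly_Mapping.lookup u e))"

text \<open>The sum of all terms of \<open>f\<close> whose exponent has the largest cost (and 0 for \<open>f = 0\<close>).\<close>

definition initial_form :: "('v \<Rightarrow> real) \<Rightarrow> ('v, 'k::field) mpoly \<Rightarrow> ('v, 'k) mpoly" where
  "initial_form c f =
     (\<Sum>u \<in> {u \<in> Poly_Mapping.keys f. \<forall>v \<in> Poly_Mapping.keys f. cost c v \<le> cost c u}.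
        Poly_Mapping.single u (Poly_Mapping.lookup f u))"

definition initial_ideal ::
    "'v set \<Rightarrow> ('v \<Rightarrow> real) \<Rightarrow> ('v, 'k::field) mpoly set \<Rightarrow> ('v, 'k) mpoly set" where
  "initial_ideal V c I = genideal (mpoly_ring V) (initial_form c ` I)"

section \<open>Standard pairs and arithmetic degree\<close>

definition admissible_pair ::
    "'v set \<Rightarrow> ('v, 'k::field) mpoly set \<Rightarrow> 'v expo \<Rightarrow> 'v set \<Rightarrow> bool" where
  "admissible_pair V J a \<sigma> \<longleftrightarrow>
     a \<in> expos V \<and> \<sigma> \<subseteq> V \<and> Poly_Mapping.keys a \<inter> \<sigma> = {} \<and>
     (\<forall>w. Poly_Mapping.keys w \<subseteq> \<sigma> \<longrightarrow> xpow a * xpow w \<notin> J)"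

text \<open>
  Below, \<open>a = a' + b\<close> says that the monomial of \<open>a'\<close> divides that of \<open>a\<close>, with quotient the
  monomial of \<open>b\<close>.
\<close>

definition standard_pair ::
    "'v set \<Rightarrow> ('v, 'k::field) mpoly set \<Rightarrow> 'v expo \<Rightarrow> 'v set \<Rightarrow> bool" where
  "standard_pair V J a \<sigma> \<longleftrightarrow>
     admissible_pair V J a \<sigma> \<and>
     \<not> (\<exists>a' \<sigma>'. (a', \<sigma>') \<noteq> (a, \<sigma>) \<and> admissible_pair V J a' \<sigma>' \<and>
            (\<exists>b. a = a' + b \<and> Poly_Mapping.keys b \<union> \<sigma> \<subseteq> \<sigma>'))"

text \<open>
  The value is an extended natural number, since \<^const>\<open>card\<close> would give 0 for an infinite set.
\<close>

definition arithmetic_degree :: "'v set \<Rightarrow> ('v, 'k::field) mpoly set \<Rightarrow> enat" where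
  "arithmetic_degree V J =
     (let S = {(a, \<sigma>). standard_pair V J a \<sigma>} in if finite S then enat (card S) else \<infinity>)"

section \<open>The acyclic tournament graph and its toric ideal\<close>

type_synonym arc = "nat \<times> nat"

definition arcs :: "nat \<Rightarrow> arc set" where
  "arcs d = {(i, j). 1 \<le> i \<and> i < j \<and> j \<le> d}"

text \<open>The incidence matrix; its rows are indexed by \<open>{1..d}\<close> and its columns by \<open>arcs d\<close>.\<close>

definition incidence :: "nat \<Rightarrow> arc \<Rightarrow> int" where
  "incidence v e = (if v = fst e then 1 else if v = snd e then -1 else 0)"

definition incidence_mult :: "nat \<Rightarrow> arc expo \<Rightarrow> nat \<Rightarrow> int" where
  "incidence_mult d u =
     (\<lambda>v \<in> {1..d}. \<Sum>e \<in> arcs d. incidence v e * int (Poly_Mapping.lookup u e))"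

definition toric_ideal :: "nat \<Rightarrow> (arc, 'k::field) mpoly set" where
  "toric_ideal d = genideal (mpoly_ring (arcs d))
     {xpow u - xpow v | u v. u \<in> expos (arcs d) \<and> v \<in> expos (arcs d) \<and>
        incidence_mult d u = incidence_mult d v}"

definition generic_cost :: "nat \<Rightarrow> (arc \<Rightarrow> real) \<Rightarrow> bool" where
  "generic_cost d c \<longleftrightarrow>
     (\<forall>b \<in> incidence_mult d ` expos (arcs d).
        \<exists>!x. is_arg_min (cost c) (\<lambda>x. x \<in> expos (arcs d) \<and> incidence_mult d x = b) x)"

section \<open>Catalan numbers\<close>

definition catalan :: "nat \<Rightarrow> nat" where
  "catalan n = ((2 * n) choose n) div (n + 1)"

lemma of_nat_catalan: "real (catalan n) = 1 / real (n + 1) * real ((2 * n) choose n)"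
proof -
  have "(n + 1) * ((2 * n) choose (n + 1)) = n * ((2 * n) choose n)"
  proof -
    have "(2 * n - n) * ((2 * n) choose n) = 2 * n * ((2 * n - 1) choose n)"
      by (rule binomial_absorb_comp)
    moreover have "Suc n * ((2 * n) choose Suc n) = 2 * n * ((2 * n - 1) choose n)"
      by (rule binomial_absorption)
    moreover have "2 * n - n = n" by simp
    ultimately show ?thesis by (metis Suc_eq_plus1)
  qed
  hence "(n + 1) * ((2 * n) choose n) =
         (n + 1) * ((2 * n) choose (n + 1)) + ((2 * n) choose n)"
    by simp
  hence "(n + 1) dvd ((2 * n) choose n)"
    by (metis dvd_add_right_iff dvd_triv_left)
  thus ?thesis
    by (simp add: catalan_def real_of_nat_div field_simps)
qed

end

theory Submission
  imports Defs
begin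

text \<open>
  Circulations on the tournament decompose into conformal \<open>0, \<plusminus>1\<close>-cycles, so optimality
  of an exponent vector depends only on its support, the initial ideal is squarefree, and its
  standard pairs are the \<open>(1, \<sigma>)\<close> with \<open>\<sigma>\<close> a facet of the regular triangulation defined by \<open>c\<close>.
  All facets have at least \<open>d - 1\<close> elements.  For \<open>c\<^sub>i\<^sub>j = -(j - i)\<^sup>2\<close> they are the noncrossing
  alternating trees, which satisfy the Catalan recurrence, and optimal vectors moreover have minimal
  total degree.  Counting the vectors \<open>A u\<close> with \<open>\<bar>u\<bar> \<le> m\<close> through the facets of an arbitrary
  generic \<open>c\<close> (from below) and through the noncrossing alternating trees (from above) and letting
  \<open>m\<close> tend to infinity shows that no triangulation has more facets.
\<close>

section \<open>The Catalan recurrence\<close>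

text \<open>The number of facets varies with \<open>c\<close> because total degree is not constant
  on the fibres of \<open>A\<close>: for \<open>d = 3\<close> the toric ideal is generated by x12
  x23 - x13, and taking x13 or x12 x23 as leading term gives one facet or two. All triangulations
  subdivide the same cone, but the simplices spanned by 0 and the columns of a facet need not fill
  the same region. Noncrossing alternating trees give a shortest vector in every fibre, hence the
  extremal case, and the comparison can only be an inequality. No volume is computed; a bound
  between binomial coefficients for all \<open>m\<close> replaces it. Unimodularity enters only as
  uniqueness: distinct optimal vectors have distinct images under \<open>A\<close>, so these images
  are counted as exponent vectors. A larger facet only adds to the lower count, so a lower bound on
  facet size suffices.\<close>

lemma catalan_Suc_rec: "(n + 2) * catalan (Suc n) = (4 * n + 2) * catalan n"
proof -
  have cat: "(m + 1) * catalan m = (2 * m) choose m" for m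
  proof -
    have "real ((m + 1) * catalan m) = real ((2 * m) choose m)"
      unfolding of_nat_mult of_nat_catalan by simp
    thus ?thesis by (simp only: of_nat_eq_iff)
  qed
  have "(n + 1) * ((2 * Suc n) choose Suc n) = 2 * (2 * n + 1) * ((2 * n) choose n)"
  proof -
    have "Suc n * ((2 * Suc n) choose Suc n) = 2 * Suc n * (Suc (2 * n) choose n)"
      using binomial_absorption[of n "2 * Suc n"] by simp
    hence "(2 * Suc n) choose Suc n = 2 * (Suc (2 * n) choose n)"
      by (metis Suc_not_Zero mult.assoc mult.left_commute mult_cancel_left)
    moreover have "Suc n * (Suc (2 * n) choose n) = Suc (2 * n) * ((2 * n) choose n)"
      using binomial_absorb_comp[of "Suc (2 * n)" n] by (simp add: Suc_diff_le)
    ultimately show ?thesis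
      by (metis Suc_eq_plus1 mult.assoc mult.left_commute)
  qed
  hence "(n + 1) * ((n + 2) * catalan (Suc n)) = (n + 1) * ((4 * n + 2) * catalan n)"
    unfolding cat[of n, symmetric] cat[of "Suc n", symmetric]
    by (simp add: algebra_simps)
  thus ?thesis by (metis Suc_eq_plus1 Suc_not_Zero mult_cancel_left)
qed

text \<open>
  Summing \<open>(i + 1) C\<^sub>i C\<^sub>n\<^sub>-\<^sub>i\<close> once by the symmetry \<open>i \<leftrightarrow> n - i\<close> and once by the
  two-term recurrence turns the convolution into a first-order recurrence.
\<close>

lemma catalan_convolution: "(\<Sum>i\<le>n. catalan i * catalan (n - i)) = catalan (Suc n)"
proof (induction n)
  case 0
  show ?case by (simp add: catalan_def numeral_2_eq_2)
next
  case (Suc n)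
  define S where "S m = (\<Sum>i\<le>m. catalan i * catalan (m - i))" for m
  define T where "T m = (\<Sum>i\<le>m. i * (catalan i * catalan (m - i)))" for m
  have T: "2 * T m = m * S m" for m
  proof -
    have "T m = (\<Sum>i\<le>m. (m - i) * (catalan (m - i) * catalan i))"
      unfolding T_def atMost_atLeast0
      by (subst sum.atLeastAtMost_rev) (intro sum.cong, auto)
    hence "T m + T m = (\<Sum>i\<le>m. (m - i) * (catalan (m - i) * catalan i) +
              i * (catalan i * catalan (m - i)))"
      by (simp add: sum.distrib T_def)
    also have "\<dots> = (\<Sum>i\<le>m. m * (catalan i * catalan (m - i)))"
    proof (intro sum.cong refl)
      fix i assume "i \<in> {..m}"
      hence *: "(m - i) * x + i * x = m * x" for x by (simp flip: add_mult_distrib)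
      show "(m - i) * (catalan (m - i) * catalan i) + i * (catalan i * catalan (m - i)) =
          m * (catalan i * catalan (m - i))"
        unfolding mult.commute[of "catalan (m - i)"] by (rule *)
    qed
    finally show ?thesis by (simp add: S_def sum_distrib_left)
  qed
  have "T (Suc n) + S (Suc n) = (\<Sum>i\<le>Suc n. (i + 1) * catalan i * catalan (Suc n - i))"
    by (simp add: T_def S_def sum.distrib algebra_simps)
  also have "\<dots> = catalan (Suc n) + (\<Sum>i\<le>n. ((i + 2) * catalan (Suc i)) * catalan (n - i))"
    by (subst sum.atMost_Suc_shift) (simp add: catalan_def[of 0])
  also have "\<dots> = catalan (Suc n) + (4 * T n + 2 * S n)"
    unfolding catalan_Suc_rec
    by (simp add: T_def S_def sum.distrib algebra_simps sum_distrib_left)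
  also have "4 * T n + 2 * S n = (2 * n + 2) * catalan (Suc n)"
    using T[of n] Suc.IH by (simp add: S_def algebra_simps)
  finally have "2 * (T (Suc n) + S (Suc n)) = 2 * ((2 * n + 3) * catalan (Suc n))"
    by (simp add: algebra_simps)
  hence "(n + 3) * S (Suc n) = 2 * ((2 * n + 3) * catalan (Suc n))"
    using T[of "Suc n"] by (simp add: algebra_simps)
  also have "\<dots> = (n + 3) * catalan (Suc (Suc n))"
    using catalan_Suc_rec[of "Suc n"] by (simp add: algebra_simps)
  finally have "S (Suc n) = catalan (Suc (Suc n))" by simp
  thus ?case by (simp add: S_def)
qed

section \<open>Noncrossing alternating trees\<close>

text \<open>
  For arcs, the case \<open>k < j\<close> of the forbidden pattern is a crossing, while \<open>k = j\<close> is a directed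
  path \<open>i \<rightarrow> j \<rightarrow> l\<close>, i.e. a failure of alternation.
\<close>

definition nca :: "arc set \<Rightarrow> bool" where
  "nca U \<longleftrightarrow> (\<forall>(i, j) \<in> U. \<forall>(k, l) \<in> U. \<not> (i < k \<and> k \<le> j \<and> j < l))"

definition arcs_on :: "nat \<Rightarrow> nat \<Rightarrow> arc set" where
  "arcs_on a b = {(i, j). a \<le> i \<and> i < j \<and> j \<le> b}"

lemma arcs_eq_arcs_on: "arcs d = arcs_on 1 d"
  by (auto simp: arcs_def arcs_on_def)

lemma finite_arcs_on [simp]: "finite (arcs_on a b)"
  by (rule finite_subset[of _ "{a..b} \<times> {a..b}"]) (auto simp: arcs_on_def)

lemma nca_subset: "nca U \<Longrightarrow> V \<subseteq> U \<Longrightarrow> nca V"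
  unfolding nca_def by blast

text \<open>\<open>nct a n\<close> consists of the noncrossing alternating trees on the \<open>n + 1\<close> vertices \<open>a, \<dots>, a + n\<close>.\<close>

function nct :: "nat \<Rightarrow> nat \<Rightarrow> arc set set" where
  "nct a 0 = {{}}"
| "nct a (Suc n) = (\<Union>k\<in>{..n}. (\<lambda>(S, S'). insert (a, a + Suc n) (S \<union> S')) `
                      (nct a k \<times> nct (Suc (a + k)) (n - k)))"
  by pat_completeness auto
termination by (relation "measure snd") auto

lemma nct_SucE:
  assumes "T \<in> nct a (Suc n)"
  obtains k S S' where "k \<le> n" "S \<in> nct a k" "S' \<in> nct (Suc (a + k)) (n - k)"
    "T = insert (a, a + Suc n) (S \<union> S')"
  using assms by auto

lemma nct_SucI:
  assumes "k \<le> n" "S \<in> nct a k" "S' \<in> nct (Suc (a + k)) (n - k)"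
  shows "insert (a, a + Suc n) (S \<union> S') \<in> nct a (Suc n)"
  using assms by force

lemma nct_subset: "T \<in> nct a n \<Longrightarrow> T \<subseteq> arcs_on a (a + n)"
proof (induction n arbitrary: a T rule: less_induct)
  case (less n)
  show ?case
  proof (cases n)
    case 0
    thus ?thesis using less.prems by simp
  next
    case (Suc m)
    from less.prems obtain k S S' where k: "k \<le> m" and S: "S \<in> nct a k"
      and S': "S' \<in> nct (Suc (a + k)) (m - k)" and T: "T = insert (a, a + Suc m) (S \<union> S')"
      unfolding Suc by (rule nct_SucE)
    have "S \<subseteq> arcs_on a (a + k)" "S' \<subseteq> arcs_on (Suc (a + k)) (Suc (a + m))"
      using less.IH[OF _ S] less.IH[OF _ S'] k Suc by auto
    thus ?thesis using k by (auto simp: T Suc arcs_on_def)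
  qed
qed

lemma nct_parts:
  assumes k: "k \<le> n" and S: "S \<in> nct a k" and S': "S' \<in> nct (Suc (a + k)) (n - k)"
  shows "S \<subseteq> arcs_on a (a + k)" "S' \<subseteq> arcs_on (Suc (a + k)) (a + Suc n)"
  using nct_subset[OF S] nct_subset[OF S'] k by auto

lemma nct_top: "T \<in> nct a (Suc n) \<Longrightarrow> (a, a + Suc n) \<in> T"
  by auto

lemma nct_nca: "T \<in> nct a n \<Longrightarrow> nca T"
proof (induction n arbitrary: a T rule: less_induct)
  case (less n)
  show ?case
  proof (cases n)
    case 0
    thus ?thesis using less.prems by (simp add: nca_def)
  next
    case (Suc m)
    from less.prems obtain k S S' where k: "k \<le> m" and S: "S \<in> nct a k"
      and S': "S' \<in> nct (Suc (a + k)) (m - k)" and T: "T = insert (a, a + Suc m) (S \<union> S')"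
      unfolding Suc by (rule nct_SucE)
    have *: "nca S" "nca S'"
      using less.IH[OF _ S] less.IH[OF _ S'] k Suc by auto
    have r: "a \<le> i \<and> i < j \<and> j \<le> a + k" if "(i, j) \<in> S" for i j
      using nct_parts(1)[OF k S S'] that by (auto simp: arcs_on_def)
    have r': "a + k < i \<and> i < j \<and> j \<le> a + Suc m" if "(i, j) \<in> S'" for i j
      using nct_parts(2)[OF k S S'] that by (auto simp: arcs_on_def)
    show ?thesis
      unfolding nca_def
    proof (clarify)
      fix i j i' j'
      assume e: "(i, j) \<in> T" "(i', j') \<in> T" and lt: "i < i'" "i' \<le> j" "j < j'"
      from e consider "(i, j) \<in> S" "(i', j') \<in> S" | "(i, j) \<in> S'" "(i', j') \<in> S'"
        | "(i, j) = (a, a + Suc m)" | "(i', j') = (a, a + Suc m)"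
        | "(i, j) \<in> S" "(i', j') \<in> S'" | "(i, j) \<in> S'" "(i', j') \<in> S"
        unfolding T by blast
      thus False
      proof cases
        case 1
        thus ?thesis using * lt unfolding nca_def by blast
      next
        case 2
        thus ?thesis using * lt unfolding nca_def by blast
      next
        case 3
        thus ?thesis using e(2) lt r[of i' j'] r'[of i' j'] k unfolding T by auto
      next
        case 4
        thus ?thesis using e(1) lt r[of i j] r'[of i j] k unfolding T by auto
      qed (use lt r r' in \<open>force+\<close>)
    qed
  qed
qed

lemma nct_card: "T \<in> nct a n \<Longrightarrow> card T = n"
proof (induction n arbitrary: a T rule: less_induct)
  case (less n)
  show ?case
  proof (cases n)
    case 0
    thus ?thesis using less.prems by simp
  next
    case (Suc m)
    from less.prems obtain k S S' where k: "k \<le> m" and S: "S \<in> nct a k"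
      and S': "S' \<in> nct (Suc (a + k)) (m - k)" and T: "T = insert (a, a + Suc m) (S \<union> S')"
      unfolding Suc by (rule nct_SucE)
    note sub = nct_parts[OF k S S']
    have fin: "finite S" "finite S'"
      using finite_subset[OF sub(1)] finite_subset[OF sub(2)] by simp_all
    have "(a, a + Suc m) \<notin> S \<union> S'" "S \<inter> S' = {}"
      using sub k by (fastforce simp: arcs_on_def)+
    hence "card T = Suc (card S + card S')"
      using fin by (simp add: T card_Un_disjoint)
    thus ?thesis using less.IH[OF _ S] less.IH[OF _ S'] k Suc by simp
  qed
qed

text \<open>The cut comes from the largest neighbour \<open>a + k\<close> of \<open>a\<close> below
  \<open>a + n\<close>. An arc from some \<open>i > a\<close> across the gap after
  \<open>a + k\<close> would form the forbidden pattern with \<open>(a, a + k)\<close>, and one from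
  \<open>a\<close> would contradict maximality. So apart from \<open>(a, a + n)\<close> the arcs
  fall into two intervals.\<close>

lemma nca_extends_to_nct:
  "nca U \<Longrightarrow> U \<subseteq> arcs_on a (a + n) \<Longrightarrow> \<exists>T \<in> nct a n. U \<subseteq> T"
proof (induction n arbitrary: a U rule: less_induct)
  case (less n)
  show ?case
  proof (cases n)
    case 0
    thus ?thesis using less.prems by (auto simp: arcs_on_def)
  next
    case (Suc m)
    \<comment> \<open>Inserting \<open>a\<close> makes the maximum exist; it yields
      \<open>k = 0\<close>, a one-vertex left part, when \<open>a\<close> has no neighbour below
      \<open>a + n\<close>.\<close>
    define K where "K = insert a {j. (a, j) \<in> U \<and> j < a + n}"
    define k where "k = Max K - a"
    have K: "finite K" "K \<noteq> {}" "\<And>j. j \<in> K \<Longrightarrow> a \<le> j \<and> j < a + n"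
      using less.prems(2) Suc by (auto simp: K_def arcs_on_def)
    have MK: "Max K \<in> K" using K by simp
    have ak: "a + k = Max K" using K(3)[OF MK] by (simp add: k_def)
    have km: "k \<le> m" using K(3)[OF MK] Suc by (auto simp: k_def)
    have split: "j \<le> a + k \<or> Suc (a + k) \<le> i" if ij: "(i, j) \<in> U" "(i, j) \<noteq> (a, a + n)" for i j
    proof (rule ccontr)
      assume "\<not> ?thesis"
      hence *: "i \<le> a + k" "a + k < j" by auto
      have r: "a \<le> i" "i < j" "j \<le> a + n" using less.prems(2) ij by (auto simp: arcs_on_def)
      show False
      proof (cases "i = a")
        case True
        with ij r have "j \<in> K" by (auto simp: K_def)
        hence "j \<le> Max K" using K by simp
        thus False using * ak by simp
      next
        case False
        with r * have "Max K \<noteq> a" using ak by simp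
        with MK have "(a, a + k) \<in> U" unfolding ak by (auto simp: K_def)
        with ij less.prems(1) False r * show False unfolding nca_def by fastforce
      qed
    qed
    let ?U1 = "U \<inter> arcs_on a (a + k)" and ?U2 = "U \<inter> arcs_on (Suc (a + k)) (Suc (a + k) + (m - k))"
    have "\<exists>S \<in> nct a k. ?U1 \<subseteq> S"
      using less.prems(1) km Suc by (intro less.IH) (auto intro: nca_subset)
    moreover have "\<exists>S' \<in> nct (Suc (a + k)) (m - k). ?U2 \<subseteq> S'"
      using less.prems(1) km Suc by (intro less.IH) (auto intro: nca_subset)
    ultimately obtain S S' where S: "S \<in> nct a k" "?U1 \<subseteq> S" "S' \<in> nct (Suc (a + k)) (m - k)" "?U2 \<subseteq> S'"
      by blast
    have "U \<subseteq> insert (a, a + Suc m) (S \<union> S')"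
    proof
      fix e assume e: "e \<in> U"
      obtain i j where [simp]: "e = (i, j)" by (cases e)
      have r: "a \<le> i" "i < j" "j \<le> a + n" using less.prems(2) e by (auto simp: arcs_on_def)
      show "e \<in> insert (a, a + Suc m) (S \<union> S')"
      proof (cases "(i, j) = (a, a + n)")
        case False
        with e split have "e \<in> ?U1 \<or> e \<in> ?U2"
          using r km Suc by (auto simp: arcs_on_def)
        thus ?thesis using S by blast
      qed (use Suc in auto)
    qed
    thus ?thesis using nct_SucI[OF km S(1) S(3)] Suc by blast
  qed
qed

lemma finite_nct [simp]: "finite (nct a n)"
  by (rule finite_subset[of _ "Pow (arcs_on a (a + n))"]) (use nct_subset in auto)

text \<open>The pieces for different \<open>k\<close> are disjoint because \<open>k\<close> can be
  read off the tree, and each piece is a product because the two subtrees are the restrictions to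
  the two vertex intervals.\<close>

lemma card_nct: "card (nct a n) = catalan n"
proof (induction n arbitrary: a rule: less_induct)
  case (less n)
  show ?case
  proof (cases n)
    case 0
    thus ?thesis by (simp add: catalan_def)
  next
    case (Suc m)
    define g where "g = (\<lambda>(S, S'). insert (a, a + Suc m) (S \<union> S' :: arc set))"
    define B where "B k = nct a k \<times> nct (Suc (a + k)) (m - k)" for k
    have sub: "S \<subseteq> arcs_on a (a + k)" "S' \<subseteq> arcs_on (Suc (a + k)) (a + Suc m)"
      if "k \<le> m" "(S, S') \<in> B k" for k S S'
      using nct_parts[of k m S a S'] that by (auto simp: B_def)
    \<comment> \<open>Together these say that \<open>a + k\<close> is the largest neighbour of
      \<open>a\<close> below the top vertex, with \<open>a\<close> itself as default for
      \<open>k = 0\<close>.\<close>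
    have recover: "insert a {j. (a, j) \<in> g p \<and> j < a + Suc m} \<subseteq> {..a + k}"
      "a + k \<in> insert a {j. (a, j) \<in> g p \<and> j < a + Suc m}" if "k \<le> m" "p \<in> B k" for k p
    proof -
      obtain S S' where p: "p = (S, S')" by (cases p)
      note s = sub[OF that(1), of S S'] that[unfolded p]
      show "insert a {j. (a, j) \<in> g p \<and> j < a + Suc m} \<subseteq> {..a + k}"
        using s by (auto simp: p g_def arcs_on_def)
      have "k = 0 \<or> (a, a + k) \<in> S" using s nct_top by (cases k) (auto simp: B_def)
      thus "a + k \<in> insert a {j. (a, j) \<in> g p \<and> j < a + Suc m}"
        using s by (auto simp: p g_def)
    qed
    have disj: "g ` B k \<inter> g ` B k' = {}" if "k \<le> m" "k' \<le> m" "k \<noteq> k'" for k k'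
    proof (rule ccontr)
      assume "\<not> ?thesis"
      then obtain p p' where p: "p \<in> B k" "p' \<in> B k'" "g p = g p'" by blast
      have "a + k \<le> a + k'" "a + k' \<le> a + k"
        using recover[OF that(1) p(1)] recover[OF that(2) p(2)] unfolding p(3) by blast+
      thus False using that by simp
    qed
    have inj: "inj_on g (B k)" if "k \<le> m" for k
    proof (rule inj_onI)
      have *: "S = g (S, S') \<inter> arcs_on a (a + k)" "S' = g (S, S') \<inter> arcs_on (Suc (a + k)) (a + Suc m)"
        if "(S, S') \<in> B k" for S S'
        using sub[OF \<open>k \<le> m\<close> that] \<open>k \<le> m\<close> by (auto simp: g_def arcs_on_def)
      fix p q assume "p \<in> B k" "q \<in> B k" "g p = g q"
      thus "p = q" using * by (metis prod.collapse)
    qed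
    have "card (nct a n) = card (\<Union>k\<in>{..m}. g ` B k)"
      by (simp add: Suc g_def B_def)
    also have "\<dots> = (\<Sum>k\<le>m. card (g ` B k))"
      using disj by (intro card_UN_disjoint) (auto simp: B_def)
    also have "\<dots> = (\<Sum>k\<le>m. catalan k * catalan (m - k))"
    proof (rule sum.cong)
      fix k assume k: "k \<in> {..m}"
      hence "card (g ` B k) = card (B k)" by (intro card_image inj) simp
      also have "\<dots> = catalan k * catalan (m - k)"
        using k less.IH Suc by (simp add: B_def card_cartesian_product)
      finally show "card (g ` B k) = catalan k * catalan (m - k)" .
    qed simp
    finally show ?thesis using catalan_convolution[of m] Suc by simp
  qed
qed

text \<open>All members of \<open>nct a n\<close> have \<open>n\<close> arcs, so none properly
  contains another, and every \<open>nca\<close> set lies in one of them.\<close>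

lemma maximal_nca_iff_nct:
  "T \<in> nct a n \<longleftrightarrow> nca T \<and> T \<subseteq> arcs_on a (a + n) \<and>
     (\<forall>U. nca U \<longrightarrow> U \<subseteq> arcs_on a (a + n) \<longrightarrow> T \<subseteq> U \<longrightarrow> U = T)"
proof
  assume T: "T \<in> nct a n"
  have "U = T" if U: "nca U" "U \<subseteq> arcs_on a (a + n)" "T \<subseteq> U" for U
  proof -
    obtain T' where T': "T' \<in> nct a n" "U \<subseteq> T'" using nca_extends_to_nct U by blast
    have "finite T'" using nct_subset[OF T'(1)] by (rule finite_subset) simp
    hence "T = T'" using nct_card[OF T] nct_card[OF T'(1)] U T' by (intro card_subset_eq) auto
    thus ?thesis using U T' by blast
  qed
  thus "nca T \<and> T \<subseteq> arcs_on a (a + n) \<and>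
     (\<forall>U. nca U \<longrightarrow> U \<subseteq> arcs_on a (a + n) \<longrightarrow> T \<subseteq> U \<longrightarrow> U = T)"
    using nct_nca[OF T] nct_subset[OF T] by blast
next
  assume *: "nca T \<and> T \<subseteq> arcs_on a (a + n) \<and>
     (\<forall>U. nca U \<longrightarrow> U \<subseteq> arcs_on a (a + n) \<longrightarrow> T \<subseteq> U \<longrightarrow> U = T)"
  then obtain T' where T': "T' \<in> nct a n" "T \<subseteq> T'"
    using nca_extends_to_nct[of T a n] by blast
  hence "T' = T" using * nct_nca[OF T'(1)] nct_subset[OF T'(1)] by blast
  thus "T \<in> nct a n" using T' by simp
qed

section \<open>Exponent vectors of bounded degree\<close>

abbreviation keys :: "('a \<Rightarrow>\<^sub>0 'b::zero) \<Rightarrow> 'a set" where "keys \<equiv> Poly_Mapping.keys"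
abbreviation lookup :: "('a \<Rightarrow>\<^sub>0 'b::zero) \<Rightarrow> 'a \<Rightarrow> 'b" where "lookup \<equiv> Poly_Mapping.lookup"

definition deg :: "'v expo \<Rightarrow> nat" where
  "deg u = (\<Sum>e\<in>keys u. lookup u e)"

lemma deg_superset: "finite S \<Longrightarrow> keys u \<subseteq> S \<Longrightarrow> deg u = (\<Sum>e\<in>S. lookup u e)"
  unfolding deg_def by (intro sum.mono_neutral_left) (auto simp: in_keys_iff)

lemma deg_plus: "deg (u + v) = deg u + deg v"
proof -
  let ?S = "keys u \<union> keys v"
  have "keys (u + v) \<subseteq> ?S" by (rule keys_add)
  hence "deg (u + v) = (\<Sum>e\<in>?S. lookup (u + v) e)" by (intro deg_superset) auto
  also have "\<dots> = (\<Sum>e\<in>?S. lookup u e) + (\<Sum>e\<in>?S. lookup v e)"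
    by (simp add: lookup_add sum.distrib)
  finally show ?thesis by (simp flip: deg_superset)
qed

lemma deg_single [simp]: "deg (Poly_Mapping.single e k) = k"
  by (simp add: deg_def)

lemma keys_plus_expo: "keys (u + v :: 'v expo) = keys u \<union> keys v"
  by (auto simp: in_keys_iff lookup_add)

text \<open>In spite of the name a simplex: the sum of the exponents is bounded. For finite
  \<open>T\<close> these are the lattice points of the \<open>m\<close>-fold dilated simplex on 0
  and the unit vectors of \<open>T\<close>.\<close>

definition box :: "'v set \<Rightarrow> nat \<Rightarrow> 'v expo set" where
  "box T m = {u. keys u \<subseteq> T \<and> deg u \<le> m}"

lemma box_insert:
  assumes "e \<notin> T"
  shows "box (insert e T) m = (\<Union>j\<in>{..m}. (\<lambda>u. u + Poly_Mapping.single e j) ` box T (m - j))"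
proof (intro equalityI subsetI)
  fix u assume u: "u \<in> box (insert e T) m"
  define j where "j = lookup u e"
  define u' where "u' = u - Poly_Mapping.single e j"
  have eq: "u = u' + Poly_Mapping.single e j"
    by (rule poly_mapping_eqI) (simp add: u'_def j_def lookup_add lookup_minus lookup_single when_def)
  have "keys u' \<subseteq> keys u - {e}"
    by (auto simp: in_keys_iff u'_def j_def lookup_minus lookup_single when_def split: if_splits)
  hence "keys u' \<subseteq> T" using u by (auto simp: box_def)
  moreover have "deg u = deg u' + j" by (subst eq) (simp add: deg_plus)
  ultimately show "u \<in> (\<Union>j\<in>{..m}. (\<lambda>u. u + Poly_Mapping.single e j) ` box T (m - j))"
    using u eq by (intro UN_I[of j] image_eqI[of _ _ u']) (auto simp: box_def)
next
  fix u assume "u \<in> (\<Union>j\<in>{..m}. (\<lambda>u. u + Poly_Mapping.single e j) ` box T (m - j))"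
  thus "u \<in> box (insert e T) m"
    by (auto simp: box_def keys_plus_expo deg_plus split: if_splits)
qed

text \<open>Slicing by the exponent of one variable reduces the count to the hockey-stick identity
  \<open>choose_rising_sum\<close>.\<close>

lemma finite_card_box:
  assumes "finite T"
  shows "finite (box T m) \<and> card (box T m) = (m + card T) choose card T"
  using assms
proof (induction T arbitrary: m rule: finite_induct)
  case empty
  have "box {} m = {0 :: 'a expo}" by (auto simp: box_def deg_def)
  thus ?case by simp
next
  case (insert e T)
  let ?g = "\<lambda>(j::nat) u. u + Poly_Mapping.single e j"
  have inj: "inj_on (?g j) A" for j A by (rule inj_onI) (erule add_right_imp_eq)
  have lk: "lookup u e = j" if "u \<in> ?g j ` box T k" for u j k
  proof -
    from that obtain v where "keys v \<subseteq> T" "u = ?g j v" by (auto simp: box_def)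
    thus ?thesis using insert.hyps(2) by (auto simp: lookup_add in_keys_iff)
  qed
  have "card (\<Union>j\<in>{..m}. ?g j ` box T (m - j)) = (\<Sum>j\<le>m. card (?g j ` box T (m - j)))"
  proof (rule card_UN_disjoint)
    show "\<forall>j\<in>{..m}. finite (?g j ` box T (m - j))" using insert.IH by simp
    show "\<forall>i\<in>{..m}. \<forall>j\<in>{..m}. i \<noteq> j \<longrightarrow> ?g i ` box T (m - i) \<inter> ?g j ` box T (m - j) = {}"
      using lk by (metis disjoint_iff)
  qed simp
  also have "\<dots> = (\<Sum>j\<le>m. (m - j + card T) choose card T)"
    using insert.IH by (simp add: card_image[OF inj])
  also have "\<dots> = (\<Sum>j\<le>m. (card T + j) choose card T)"
    unfolding atMost_atLeast0 by (subst sum.atLeastAtMost_rev) (intro sum.cong, auto simp: add.commute)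
  also have "\<dots> = (m + card (insert e T)) choose card (insert e T)"
    using choose_rising_sum(1)[of "card T" m] insert.hyps by (simp add: add_ac)
  finally show ?case
    using insert.IH unfolding box_insert[OF insert.hyps(2)] by simp
qed

lemma choose_add_mono: "k \<le> l \<Longrightarrow> ((m + k) choose k) \<le> ((m + l) choose l)"
  by (rule lift_Suc_mono_le) simp_all

text \<open>Raising \<open>s\<close> by one multiplies the ratio by
  \<open>1 + r / (m + s + 1)\<close>.\<close>

lemma choose_ratio_tendsto:
  "(\<lambda>m. real ((m + s + r) choose r) / real ((m + r) choose r)) \<longlonglongrightarrow> 1"
proof (induction s)
  case 0
  show ?case by simp
next
  case (Suc s)
  have pos: "((m + r) choose r) > 0" for m by simp
  have "real ((m + Suc s + r) choose r) / real ((m + r) choose r) =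
        real ((m + s + r) choose r) / real ((m + r) choose r) * (1 + real r * inverse (real (Suc (m + s))))" for m
  proof -
    have "Suc (m + s) * (Suc (m + s + r) choose r) = Suc (m + s + r) * ((m + s + r) choose r)"
      using binomial_absorb_comp[of "Suc (m + s + r)" r] by (simp add: Suc_diff_le)
    hence "real (Suc (m + s)) * real (Suc (m + s + r) choose r) =
           real (Suc (m + s + r)) * real ((m + s + r) choose r)"
      by (simp only: of_nat_mult[symmetric])
    hence "real (Suc (m + s + r) choose r) =
           real ((m + s + r) choose r) * (1 + real r * inverse (real (Suc (m + s))))"
      by (simp add: field_simps)
    thus ?thesis by simp
  qed
  moreover have "(\<lambda>m. inverse (real (Suc (m + s)))) \<longlonglongrightarrow> 0"
    using LIMSEQ_ignore_initial_segment[OF LIMSEQ_inverse_real_of_nat, of s] by simp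
  hence "(\<lambda>m. real ((m + s + r) choose r) / real ((m + r) choose r) *
           (1 + real r * inverse (real (Suc (m + s))))) \<longlonglongrightarrow> 1 * (1 + real r * 0)"
    by (intro tendsto_intros Suc.IH)
  ultimately show ?case by simp
qed

text \<open>Both binomials are polynomials in \<open>m\<close> of degree \<open>r\<close> with the
  same leading coefficient, so the shift \<open>s\<close> disappears in the limit.\<close>

lemma le_of_choose_bound:
  fixes F C r s :: nat
  assumes "\<And>m. F * ((m + r) choose r) \<le> C * ((m + s + r) choose r)"
  shows "F \<le> C"
proof -
  have "real F \<le> real C * (real ((m + s + r) choose r) / real ((m + r) choose r))" for m
  proof -
    have "real F * real ((m + r) choose r) \<le> real C * real ((m + s + r) choose r)"
      using assms[of m] by (simp only: of_nat_mult[symmetric] of_nat_le_iff)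
    thus ?thesis by (simp add: field_simps)
  qed
  moreover have "(\<lambda>m. real C * (real ((m + s + r) choose r) / real ((m + r) choose r))) \<longlonglongrightarrow> real C * 1"
    by (intro tendsto_intros choose_ratio_tendsto)
  ultimately have "real F \<le> real C * 1"
    by (intro LIMSEQ_le_const) auto
  thus ?thesis by simp
qed

text \<open>Adding \<open>ind T\<close> to a vector supported on a finite \<open>T\<close> makes the
  support exactly \<open>T\<close>: points of a closed cone move into its relative interior.\<close>

definition ind :: "'v set \<Rightarrow> 'v expo" where
  "ind T = (\<Sum>e\<in>T. Poly_Mapping.single e 1)"

lemma lookup_ind: "finite T \<Longrightarrow> lookup (ind T) e = (if e \<in> T then 1 else 0)"
  by (simp add: ind_def lookup_sum lookup_single when_def)

lemma keys_ind: "finite T \<Longrightarrow> keys (ind T) = T"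
  by (auto simp: in_keys_iff lookup_ind split: if_splits)

lemma deg_ind: "finite T \<Longrightarrow> deg (ind T) = card T"
  by (simp add: deg_def keys_ind lookup_ind)

section \<open>Circulations and optimal exponent vectors\<close>

lemma finite_arcs [simp]: "finite (arcs d)"
  by (simp add: arcs_eq_arcs_on)

definition balance :: "nat \<Rightarrow> (arc \<Rightarrow> int) \<Rightarrow> nat \<Rightarrow> int" where
  "balance d z v = (\<Sum>e\<in>arcs d. incidence v e * z e)"

lemma balance_diff: "balance d (\<lambda>e. y e - z e) v = balance d y v - balance d z v"
  by (simp add: balance_def algebra_simps sum_subtractf)

lemma balance_minus: "balance d (\<lambda>e. - z e) v = - balance d z v"
  by (simp add: balance_def sum_negf)

lemma incidence_mult_eq_iff:
  "incidence_mult d u = incidence_mult d w \<longleftrightarrow>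
     (\<forall>v\<in>{1..d}. balance d (\<lambda>e. int (lookup w e) - int (lookup u e)) v = 0)"
  by (auto simp: incidence_mult_def balance_def algebra_simps sum_subtractf
           restrict_def fun_eq_iff)

lemma sum_potential_incidence:
  assumes "e \<in> arcs d"
  shows "(\<Sum>v\<in>{1..d}. \<phi> v * incidence v e) = \<phi> (fst e) - \<phi> (snd e)"
proof -
  have e: "fst e \<in> {1..d}" "snd e \<in> {1..d}" "fst e \<noteq> snd e"
    using assms by (auto simp: arcs_def)
  have "(\<Sum>v\<in>{1..d}. \<phi> v * incidence v e) =
        (\<Sum>v\<in>{1..d}. (if v = fst e then \<phi> v else 0) - (if v = snd e then \<phi> v else 0))"
    using e by (intro sum.cong) (auto simp: incidence_def)
  thus ?thesis using e by (simp add: sum_subtractf)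
qed

text \<open>Summation by parts: each potential \<open>\<phi>\<close> gives a weighting of arcs whose
  total is constant on fibres. The potentials used below are the indicator of a cut,
  \<open>- int v\<close>, and the indicator of the sources.\<close>

lemma sum_potential_balance:
  "(\<Sum>v\<in>{1..d}. \<phi> v * balance d z v) = (\<Sum>e\<in>arcs d. (\<phi> (fst e) - \<phi> (snd e)) * z e)"
proof -
  have "(\<Sum>v\<in>{1..d}. \<phi> v * balance d z v) = (\<Sum>e\<in>arcs d. \<Sum>v\<in>{1..d}. \<phi> v * incidence v e * z e)"
    unfolding balance_def sum_distrib_left by (subst sum.swap) (simp add: mult.assoc)
  also have "\<dots> = (\<Sum>e\<in>arcs d. (\<phi> (fst e) - \<phi> (snd e)) * z e)"
    by (intro sum.cong refl) (simp only: sum_potential_incidence flip: sum_distrib_right)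
  finally show ?thesis .
qed

lemma expos_eqI:
  "u \<in> expos V \<Longrightarrow> w \<in> expos V \<Longrightarrow> (\<And>e. e \<in> V \<Longrightarrow> lookup u e = lookup w e) \<Longrightarrow> u = w"
  by (rule poly_mapping_eqI) (metis expos_def mem_Collect_eq not_in_keys_iff_lookup_eq_zero subsetD)

text \<open>Agreement in sign lets a cycle be traded: for \<open>z = v - u\<close> with
  \<open>u\<close> and \<open>v\<close> nonnegative, both \<open>u + y\<close> and
  \<open>v - y\<close> stay nonnegative.\<close>

definition conformal :: "nat \<Rightarrow> (arc \<Rightarrow> int) \<Rightarrow> (arc \<Rightarrow> int) \<Rightarrow> bool" where
  "conformal d y z \<longleftrightarrow> (\<forall>e\<in>arcs d. y e = 0 \<or> y e = 1 \<and> z e > 0 \<or> y e = -1 \<and> z e < 0)"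

text \<open>
  Following arcs in the direction of the flow gives a self-map of the set of active vertices;
  a minimal nonempty invariant set carries a directed cycle.
\<close>

lemma conformal_cycle:
  assumes bal: "\<And>v. v \<in> {1..d} \<Longrightarrow> balance d z v = 0"
    and nz: "\<exists>e\<in>arcs d. z e \<noteq> 0"
  obtains y where "conformal d y z" "\<And>v. balance d y v = 0" "\<exists>e\<in>arcs d. y e \<noteq> 0"
proof -
  define R where "R i j \<longleftrightarrow> (i, j) \<in> arcs d \<and> z (i, j) > 0 \<or> (j, i) \<in> arcs d \<and> z (j, i) < 0" for i j
  define W where "W = {i. \<exists>j. R i j}"
  have R_vertex: "i \<in> {1..d}" "j \<in> {1..d}" if "R i j" for i j
    using that by (auto simp: R_def arcs_def)
  have finW: "finite W"
    by (rule finite_subset[of _ "{1..d}"]) (use R_vertex in \<open>auto simp: W_def\<close>)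
  \<comment> \<open>Conservation at \<open>j\<close>: if no flow left \<open>j\<close>, all terms of
    its balance would be at most 0 and hence vanish, yet the arc joining \<open>i\<close> and
    \<open>j\<close> carries flow.\<close>
  have continue: "j \<in> W" if "R i j" for i j
  proof (rule ccontr)
    assume "j \<notin> W"
    hence out: "\<not> R j k" for k by (auto simp: W_def)
    have neg: "incidence j e * z e \<le> 0" if "e \<in> arcs d" for e
      using out[of "snd e"] out[of "fst e"] that
      by (cases e) (auto simp: incidence_def R_def)
    have "(\<Sum>e\<in>arcs d. - (incidence j e * z e)) = 0"
      using bal[of j] R_vertex[OF that] by (simp add: balance_def sum_negf)
    hence zero: "incidence j e * z e = 0" if "e \<in> arcs d" for e
      using that neg by (subst (asm) sum_nonneg_eq_0_iff) auto
    from \<open>R i j\<close> show False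
      using zero[of "(i, j)"] zero[of "(j, i)"] by (auto simp: R_def incidence_def arcs_def)
  qed
  define g where "g i = (SOME j. R i j)" for i
  have g: "R i (g i)" if "i \<in> W" for i
    using that unfolding g_def W_def by (auto intro: someI_ex)
  have gW: "g ` W \<subseteq> W" using g continue by blast
  have "W \<noteq> {}"
  proof -
    from nz obtain i j where "(i, j) \<in> arcs d" "z (i, j) \<noteq> 0" by auto
    hence "R i j \<or> R j i" by (auto simp: R_def)
    thus ?thesis by (auto simp: W_def)
  qed
  define invar where "invar C \<longleftrightarrow> C \<subseteq> W \<and> C \<noteq> {} \<and> g ` C \<subseteq> C" for C
  have "invar W" using gW \<open>W \<noteq> {}\<close> by (simp add: invar_def)
  then obtain C where C: "invar C" and min: "\<And>D. invar D \<Longrightarrow> card C \<le> card D"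
    using ex_has_least_nat[of invar W card] by auto
  have CW: "C \<subseteq> W" and Cne: "C \<noteq> {}" and gC: "g ` C \<subseteq> C" using C by (auto simp: invar_def)
  have finC: "finite C" using CW finW by (rule finite_subset)
  have "invar (g ` C)" using CW Cne gC by (auto simp: invar_def)
  hence "card C \<le> card (g ` C)" by (rule min)
  \<comment> \<open>Minimality forces \<open>g\<close> to permute \<open>C\<close>, so each vertex
    of \<open>C\<close> is left once and entered once.\<close>
  hence img: "g ` C = C" using finC gC by (intro card_seteq) auto
  hence inj: "inj_on g C" using finC by (intro eq_card_imp_inj_on) auto
  have R_asym: "\<not> R j i" if "R i j" for i j
    using that by (auto simp: R_def arcs_def)
  \<comment> \<open>The value is 1 on arcs that \<open>g\<close> traverses forwards and -1 on those
    it traverses backwards; asymmetry of \<open>R\<close> keeps the two terms from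
    cancelling.\<close>
  define y :: "arc \<Rightarrow> int" where
    "y e = of_bool (fst e \<in> C \<and> g (fst e) = snd e) - of_bool (snd e \<in> C \<and> g (snd e) = fst e)" for e
  have RC: "R i (g i)" if "i \<in> C" for i using g CW that by blast
  show thesis
  proof
    show "conformal d y z"
      unfolding conformal_def
    proof
      fix e assume e: "e \<in> arcs d"
      obtain i j where ij: "e = (i, j)" by (cases e)
      have "(j, i) \<notin> arcs d" using e by (auto simp: ij arcs_def)
      thus "y e = 0 \<or> y e = 1 \<and> z e > 0 \<or> y e = -1 \<and> z e < 0"
        using RC[of i] RC[of j] e R_asym[of i j] by (auto simp: y_def ij R_def of_bool_def split: if_splits)
    qed
  next
    fix v
    have "balance d y v = (\<Sum>e\<in>arcs d. \<Sum>i\<in>C. incidence v e *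
            (of_bool (e = (i, g i)) - of_bool (e = (g i, i))))"
      unfolding balance_def
    proof (intro sum.cong refl)
      fix e :: arc
      obtain a b where ab: "e = (a, b)" by (cases e)
      have "(\<Sum>i\<in>C. of_bool (e = (i, g i)) :: int) = (\<Sum>i\<in>C. if a = i then of_bool (b = g a) else 0)"
        by (intro sum.cong) (auto simp: ab)
      moreover have "(\<Sum>i\<in>C. of_bool (e = (g i, i)) :: int) = (\<Sum>i\<in>C. if b = i then of_bool (a = g b) else 0)"
        by (intro sum.cong) (auto simp: ab)
      ultimately have "y e = (\<Sum>i\<in>C. of_bool (e = (i, g i)) - of_bool (e = (g i, i)))"
        using finC by (auto simp: y_def ab sum_subtractf)
      thus "incidence v e * y e = (\<Sum>i\<in>C. incidence v e * (of_bool (e = (i, g i)) - of_bool (e = (g i, i))))"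
        by (simp add: sum_distrib_left)
    qed
    also have "\<dots> = (\<Sum>i\<in>C. \<Sum>e\<in>arcs d. incidence v e *
            (of_bool (e = (i, g i)) - of_bool (e = (g i, i))))"
      by (rule sum.swap)
    also have "\<dots> = (\<Sum>i\<in>C. of_bool (v = i) - of_bool (v = g i))"
    proof (intro sum.cong refl)
      fix i assume "i \<in> C"
      hence "R i (g i)" by (rule RC)
      hence arc: "(i, g i) \<in> arcs d \<and> (g i, i) \<notin> arcs d \<or> (i, g i) \<notin> arcs d \<and> (g i, i) \<in> arcs d" "i \<noteq> g i"
        by (auto simp: R_def arcs_def)
      have "(\<Sum>e\<in>arcs d. incidence v e * (of_bool (e = (i, g i)) - of_bool (e = (g i, i)))) =
            (\<Sum>e\<in>arcs d. if e = (i, g i) then incidence v e else 0) -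
            (\<Sum>e\<in>arcs d. if e = (g i, i) then incidence v e else 0)"
        unfolding sum_subtractf[symmetric] by (intro sum.cong) auto
      also have "\<dots> = of_bool (v = i) - of_bool (v = g i)"
        using arc by (auto simp: incidence_def)
      finally show "(\<Sum>e\<in>arcs d. incidence v e * (of_bool (e = (i, g i)) - of_bool (e = (g i, i)))) =
          of_bool (v = i) - of_bool (v = g i)" .
    qed
    also have "\<dots> = (\<Sum>i\<in>C. of_bool (v = i)) - (\<Sum>i\<in>g ` C. of_bool (v = i))"
      by (simp add: sum_subtractf sum.reindex[OF inj])
    also have "\<dots> = 0" by (simp add: img)
    finally show "balance d y v = 0" .
  next
    obtain i where i: "i \<in> C" using Cne by blast
    from RC[OF i] consider "(i, g i) \<in> arcs d" | "(g i, i) \<in> arcs d" by (auto simp: R_def)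
    moreover have "\<not> (g i \<in> C \<and> g (g i) = i)" using RC[of i] RC[of "g i"] R_asym i by metis
    ultimately show "\<exists>e\<in>arcs d. y e \<noteq> 0"
      using i by cases (force simp: y_def)+
  qed
qed

lemma conformal_trans_diff:
  assumes "conformal d y z" "conformal d y' (\<lambda>e. z e - y e)"
  shows "conformal d y' z"
  unfolding conformal_def
proof
  fix e assume e: "e \<in> arcs d"
  show "y' e = 0 \<or> y' e = 1 \<and> z e > 0 \<or> y' e = -1 \<and> z e < 0"
    using assms[unfolded conformal_def, THEN bspec, OF e] by auto
qed

section \<open>Optimal vectors and the exchange of cycles\<close>

lemma cost_superset:
  "finite S \<Longrightarrow> keys u \<subseteq> S \<Longrightarrow> cost c u = (\<Sum>e\<in>S. c e * real (lookup u e))"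
  unfolding cost_def by (intro sum.mono_neutral_left) (auto simp: in_keys_iff)

lemma cost_plus: "cost c (u + w) = cost c u + cost c w"
  using cost_superset[of "keys u \<union> keys w" u c] cost_superset[of "keys u \<union> keys w" w c]
    cost_superset[of "keys u \<union> keys w" "u + w" c] keys_add[of u w]
  by (simp add: lookup_add sum.distrib algebra_simps)

lemma incidence_mult_plus:
  "incidence_mult d (u + w) = (\<lambda>v\<in>{1..d}. incidence_mult d u v + incidence_mult d w v)"
  by (rule ext) (simp add: incidence_mult_def lookup_add sum.distrib algebra_simps)

definition optimal :: "nat \<Rightarrow> (arc \<Rightarrow> real) \<Rightarrow> arc expo \<Rightarrow> bool" where
  "optimal d c u \<longleftrightarrow> u \<in> expos (arcs d) \<and>
     (\<forall>w\<in>expos (arcs d). incidence_mult d w = incidence_mult d u \<longrightarrow> w \<noteq> u \<longrightarrow> cost c u < cost c w)"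

lemma optimal_unique:
  "optimal d c u \<Longrightarrow> optimal d c w \<Longrightarrow> incidence_mult d u = incidence_mult d w \<Longrightarrow> u = w"
  unfolding optimal_def by (metis less_asym)

lemma generic_obtain_optimal:
  assumes "generic_cost d c" "u \<in> expos (arcs d)"
  obtains w where "optimal d c w" "incidence_mult d w = incidence_mult d u"
proof -
  let ?P = "\<lambda>x. x \<in> expos (arcs d) \<and> incidence_mult d x = incidence_mult d u"
  from assms obtain w where w: "is_arg_min (cost c) ?P w" and uniq: "\<And>x. is_arg_min (cost c) ?P x \<Longrightarrow> x = w"
    unfolding generic_cost_def by blast
  have "cost c w < cost c x" if "?P x" "x \<noteq> w" for x
  proof (rule ccontr)
    assume "\<not> ?thesis"
    hence "is_arg_min (cost c) ?P x" using w that(1) by (auto simp: is_arg_min_def)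
    thus False using uniq that by blast
  qed
  hence "optimal d c w" using w by (auto simp: optimal_def is_arg_min_def)
  thus thesis using w that by (auto simp: is_arg_min_def)
qed

lemma optimal_cycle_cost_pos:
  assumes u: "optimal d c u" and bal: "\<And>v. balance d y v = 0"
    and nonneg: "\<And>e. e \<in> arcs d \<Longrightarrow> int (lookup u e) + y e \<ge> 0"
    and nz: "\<exists>e\<in>arcs d. y e \<noteq> 0"
  shows "(\<Sum>e\<in>arcs d. c e * real_of_int (y e)) > 0"
proof -
  define w where "w = (\<Sum>e\<in>arcs d. Poly_Mapping.single e (nat (int (lookup u e) + y e)))"
  have lk: "lookup w e = (if e \<in> arcs d then nat (int (lookup u e) + y e) else 0)" for e
    by (simp add: w_def lookup_sum lookup_single when_def)
  hence ilk: "int (lookup w e) = int (lookup u e) + y e" if "e \<in> arcs d" for e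
    using nonneg that by simp
  have w: "w \<in> expos (arcs d)" using lk by (auto simp: expos_def in_keys_iff split: if_splits)
  have "balance d (\<lambda>e. int (lookup w e) - int (lookup u e)) v = balance d y v" for v
    unfolding balance_def by (intro sum.cong) (simp_all add: ilk)
  hence "incidence_mult d u = incidence_mult d w" by (simp add: incidence_mult_eq_iff bal)
  moreover have "w \<noteq> u" using nz ilk by force
  ultimately have less: "cost c u < cost c w" using u w by (auto simp: optimal_def)
  have "cost c w = (\<Sum>e\<in>arcs d. c e * real (lookup w e))"
    using w by (intro cost_superset) (auto simp: expos_def)
  also have "\<dots> = (\<Sum>e\<in>arcs d. c e * real (lookup u e) + c e * real_of_int (y e))"
  proof (intro sum.cong refl)
    fix e assume "e \<in> arcs d"
    hence "real (lookup w e) = real (lookup u e) + real_of_int (y e)"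
      using ilk by (metis of_int_add of_int_of_nat_eq)
    thus "c e * real (lookup w e) = c e * real (lookup u e) + c e * real_of_int (y e)"
      by (simp add: algebra_simps)
  qed
  also have "\<dots> = cost c u + (\<Sum>e\<in>arcs d. c e * real_of_int (y e))"
    using u by (subst cost_superset[of "arcs d"]) (auto simp: optimal_def expos_def sum.distrib)
  finally show ?thesis using less by simp
qed

text \<open>A cycle available at two optimal vectors in opposite directions would have cost both
  positive and negative.\<close>

lemma optimal_no_common_cycle:
  assumes "optimal d c u" "optimal d c w" "\<And>v. balance d y v = 0" "\<exists>e\<in>arcs d. y e \<noteq> 0"
    "\<And>e. e \<in> arcs d \<Longrightarrow> int (lookup u e) + y e \<ge> 0"
    "\<And>e. e \<in> arcs d \<Longrightarrow> int (lookup w e) - y e \<ge> 0"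
  shows False
proof -
  have "(\<Sum>e\<in>arcs d. c e * real_of_int (y e)) > 0"
    using assms by (intro optimal_cycle_cost_pos[of d c u]) auto
  moreover have "(\<Sum>e\<in>arcs d. c e * real_of_int (- y e)) > 0"
    using assms by (intro optimal_cycle_cost_pos[of d c w]) (auto simp: balance_minus)
  ultimately show False by (simp add: sum_negf)
qed

text \<open>Let \<open>v\<close> be the optimum in the fibre of \<open>w\<close>. A conformal cycle
  of \<open>v - w\<close> removes at most one unit, and only from arcs of \<open>w\<close>, which
  are arcs of \<open>u\<close>. So it fits \<open>u\<close> and its reverse fits \<open>v\<close>,
  even if \<open>u\<close> lies in another fibre. Because the entries are 0, 1 and -1, one unit in
  \<open>u\<close> is enough.\<close>

lemma optimal_mono_support:
  assumes gen: "generic_cost d c" and u: "optimal d c u" and sub: "keys w \<subseteq> keys u"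
  shows "optimal d c w"
proof -
  have w: "w \<in> expos (arcs d)" using u sub by (auto simp: optimal_def expos_def)
  from generic_obtain_optimal[OF gen w] obtain v
    where v: "optimal d c v" "incidence_mult d v = incidence_mult d w" .
  define z where "z e = int (lookup v e) - int (lookup w e)" for e
  have "v = w"
  proof (rule ccontr)
    assume "v \<noteq> w"
    hence "\<exists>e\<in>arcs d. lookup v e \<noteq> lookup w e"
      using v(1) w expos_eqI[of v "arcs d" w] by (auto simp: optimal_def)
    hence "\<exists>e\<in>arcs d. z e \<noteq> 0" by (simp add: z_def)
    moreover have "balance d z x = 0" if "x \<in> {1..d}" for x
      using v(2)[symmetric] that unfolding incidence_mult_eq_iff z_def by blast
    ultimately obtain y where y: "conformal d y z" "\<And>x. balance d y x = 0" "\<exists>e\<in>arcs d. y e \<noteq> 0"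
      using conformal_cycle[of d z] by blast
    have "int (lookup u e) + y e \<ge> 0" "int (lookup v e) - y e \<ge> 0" if "e \<in> arcs d" for e
    proof -
      have "lookup w e > 0 \<Longrightarrow> lookup u e > 0" using sub in_keys_iff[of e w] in_keys_iff[of e u] by auto
      thus "int (lookup u e) + y e \<ge> 0" "int (lookup v e) - y e \<ge> 0"
        using y(1)[unfolded conformal_def, THEN bspec, OF that] by (auto simp: z_def)
    qed
    thus False using optimal_no_common_cycle[OF u v(1) y(2,3)] by blast
  qed
  thus ?thesis using v by simp
qed

section \<open>The complex of supports of optimal vectors\<close>

definition face :: "nat \<Rightarrow> (arc \<Rightarrow> real) \<Rightarrow> arc set \<Rightarrow> bool" where
  "face d c \<sigma> \<longleftrightarrow> \<sigma> \<subseteq> arcs d \<and> optimal d c (ind \<sigma>)"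

definition facets :: "nat \<Rightarrow> (arc \<Rightarrow> real) \<Rightarrow> arc set set" where
  "facets d c = {\<sigma>. face d c \<sigma> \<and> (\<forall>\<tau>. face d c \<tau> \<longrightarrow> \<sigma> \<subseteq> \<tau> \<longrightarrow> \<tau> = \<sigma>)}"

lemma finite_subset_arcs: "\<sigma> \<subseteq> arcs d \<Longrightarrow> finite \<sigma>"
  by (rule finite_subset[OF _ finite_arcs])

lemma finite_facets [simp]: "finite (facets d c)"
  by (rule finite_subset[of _ "Pow (arcs d)"]) (auto simp: facets_def face_def)

lemma optimal_iff_face:
  assumes "generic_cost d c"
  shows "optimal d c u \<longleftrightarrow> face d c (keys u)"
proof -
  have "keys (ind (keys u)) = keys u" by (simp add: keys_ind)
  thus ?thesis
    using optimal_mono_support[OF assms, of u "ind (keys u)"]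
      optimal_mono_support[OF assms, of "ind (keys u)" u]
    by (auto simp: face_def optimal_def expos_def)
qed

text \<open>
  The optimal vector equivalent to \<open>2 \<cdot> ind \<sigma> + e\<close> differs from it by a single cycle through \<open>e\<close>,
  so its support still contains \<open>\<sigma>\<close> and hence equals \<open>\<sigma>\<close>.  Thus \<open>e\<close> lies in the span of \<open>\<sigma>\<close>.
\<close>

lemma facet_crosses_cut:
  assumes gen: "generic_cost d c" and \<sigma>: "\<sigma> \<in> facets d c"
    and e: "e \<in> arcs d" "fst e \<in> S \<longleftrightarrow> snd e \<notin> S"
  obtains f where "f \<in> \<sigma>" "fst f \<in> S \<longleftrightarrow> snd f \<notin> S"
proof (cases "e \<in> \<sigma>")
  case False
  note crossing = that
  have face: "face d c \<sigma>" and max: "\<And>\<tau>. face d c \<tau> \<Longrightarrow> \<sigma> \<subseteq> \<tau> \<Longrightarrow> \<tau> = \<sigma>"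
    using \<sigma> by (auto simp: facets_def)
  have sub: "\<sigma> \<subseteq> arcs d" and opt: "optimal d c (ind \<sigma>)" using face by (auto simp: face_def)
  note fin = finite_subset_arcs[OF sub]
  \<comment> \<open>The coefficient 2 leaves a unit on every arc of \<open>\<sigma>\<close> after
    one unit has been removed.\<close>
  define u where "u = ind \<sigma> + ind \<sigma> + Poly_Mapping.single e 1"
  have lu: "lookup u f = (if f \<in> \<sigma> then 2 else if f = e then 1 else 0)" for f
    using False fin by (auto simp: u_def lookup_add lookup_ind lookup_single when_def)
  have ku: "keys u = insert e \<sigma>" by (auto simp: in_keys_iff lu split: if_splits)
  hence uV: "u \<in> expos (arcs d)" using sub e by (auto simp: expos_def)
  from generic_obtain_optimal[OF gen uV] obtain v
    where v: "optimal d c v" "incidence_mult d v = incidence_mult d u" .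
  have vV: "keys v \<subseteq> arcs d" using v by (auto simp: optimal_def expos_def)
  have "v \<noteq> u"
  proof
    assume "v = u"
    hence "face d c (insert e \<sigma>)" using v(1) optimal_iff_face[OF gen, of u] ku by simp
    thus False using max[of "insert e \<sigma>"] False by blast
  qed
  define z where "z f = int (lookup v f) - int (lookup u f)" for f
  have "\<exists>f\<in>arcs d. lookup v f \<noteq> lookup u f"
    using \<open>v \<noteq> u\<close> v(1) uV expos_eqI[of v "arcs d" u] by (auto simp: optimal_def)
  hence nz: "\<exists>f\<in>arcs d. z f \<noteq> 0" by (simp add: z_def)
  have bal: "balance d z x = 0" if "x \<in> {1..d}" for x
    using v(2)[symmetric] that unfolding incidence_mult_eq_iff z_def by blast
  \<comment> \<open>A cycle that does not remove \<open>e\<close> removes units only on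
    \<open>\<sigma>\<close>, so it fits \<open>ind \<sigma>\<close> while its reverse fits
    \<open>v\<close>, and both are optimal.\<close>
  have through_e: "y e = -1" if y: "conformal d y z" "\<And>x. balance d y x = 0" "\<exists>f\<in>arcs d. y f \<noteq> 0" for y
  proof (rule ccontr)
    assume ye: "y e \<noteq> -1"
    have "int (lookup (ind \<sigma>) f) + y f \<ge> 0" "int (lookup v f) - y f \<ge> 0" if "f \<in> arcs d" for f
      using y(1)[unfolded conformal_def, THEN bspec, OF that] ye fin
      by (auto simp: z_def lu lookup_ind split: if_splits)
    thus False using optimal_no_common_cycle[OF opt v(1) y(2,3)] by blast
  qed
  obtain y where y: "conformal d y z" "\<And>x. balance d y x = 0" "\<exists>f\<in>arcs d. y f \<noteq> 0"
    using conformal_cycle[of d z] bal nz by blast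
  \<comment> \<open>A second cycle would have to remove \<open>e\<close> again, but \<open>u\<close>
    contains \<open>e\<close> only once.\<close>
  have zy: "z f = y f" if f: "f \<in> arcs d" for f
  proof (rule ccontr)
    assume "z f \<noteq> y f"
    hence "\<exists>f\<in>arcs d. z f - y f \<noteq> 0" using f by auto
    then obtain y' where y': "conformal d y' (\<lambda>f. z f - y f)" "\<And>x. balance d y' x = 0"
      "\<exists>f\<in>arcs d. y' f \<noteq> 0"
      using conformal_cycle[of d "\<lambda>f. z f - y f"] bal y(2) by (auto simp: balance_diff)
    have "y' e = -1" using y' conformal_trans_diff[OF y(1) y'(1)] by (intro through_e)
    hence "z e - y e < 0" using y'(1) e(1) by (force simp: conformal_def)
    thus False using through_e[OF y] False by (simp add: z_def lu)
  qed
  have ze: "z e = -1" using zy[OF e(1)] through_e[OF y] by simp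
  have "\<sigma> \<subseteq> keys v"
  proof
    fix f assume f: "f \<in> \<sigma>"
    hence "z f \<ge> -1" using sub zy[of f] y(1) by (force simp: conformal_def)
    thus "f \<in> keys v" using f by (auto simp: in_keys_iff z_def lu)
  qed
  hence kv: "keys v = \<sigma>" using max v(1) optimal_iff_face[OF gen] by blast
  show thesis
  proof (rule ccontr)
    assume "\<not> thesis"
    hence no: "fst f \<in> S \<longleftrightarrow> snd f \<in> S" if "f \<in> \<sigma>" for f using that crossing by blast
    \<comment> \<open>With the indicator of \<open>S\<close> as potential, arcs of
      \<open>\<sigma>\<close> contribute 0 because they do not cross the cut, and outside
      \<open>\<sigma>\<close> only \<open>e\<close> has nonzero \<open>z\<close>. The term of
      \<open>e\<close> is left with nothing to balance it.\<close>
    let ?\<phi> = "\<lambda>v. of_bool (v \<in> S) :: int"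
    have "(\<Sum>f\<in>arcs d. (?\<phi> (fst f) - ?\<phi> (snd f)) * z f) = 0"
      using bal by (subst sum_potential_balance[of ?\<phi> d z, symmetric]) simp
    moreover have "(?\<phi> (fst f) - ?\<phi> (snd f)) * z f = 0" if "f \<in> arcs d - {e}" for f
      using no[of f] that kv by (cases "f \<in> \<sigma>") (auto simp: z_def lu in_keys_iff)
    ultimately have "(?\<phi> (fst e) - ?\<phi> (snd e)) * z e = 0"
      using e(1) by (simp add: sum.remove)
    thus False using e(2) ze by (auto simp: of_bool_def split: if_splits)
  qed
qed (use e that in blast)

text \<open>Every cut is crossed by an arc of the tournament, hence by one of
  \<open>\<sigma>\<close>. Growing a vertex set through such arcs gains a new arc with each vertex,
  as in building a spanning tree.\<close>

lemma card_facet_ge: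
  assumes gen: "generic_cost d c" and \<sigma>: "\<sigma> \<in> facets d c"
  shows "d - 1 \<le> card \<sigma>"
proof (cases "d = 0")
  case False
  have sub: "\<sigma> \<subseteq> arcs d" using \<sigma> by (auto simp: facets_def face_def)
  note fin = finite_subset_arcs[OF sub]
  have "k < d \<Longrightarrow> \<exists>S\<subseteq>{1..d}. card S = Suc k \<and> k \<le> card {f \<in> \<sigma>. fst f \<in> S \<and> snd f \<in> S}" for k
  proof (induction k)
    case 0
    thus ?case by (intro exI[of _ "{1}"]) auto
  next
    case (Suc k)
    then obtain S where S: "S \<subseteq> {1..d}" "card S = Suc k" "k \<le> card {f \<in> \<sigma>. fst f \<in> S \<and> snd f \<in> S}"
      by auto
    have finS: "finite S" using S(1) by (rule finite_subset) simp
    obtain a where a: "a \<in> S" using S(2) by fastforce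
    have "S \<noteq> {1..d}" using S(2) Suc.prems by auto
    then obtain b where b: "b \<in> {1..d}" "b \<notin> S" using S(1) by blast
    have "(min a b, max a b) \<in> arcs d" "min a b \<in> S \<longleftrightarrow> max a b \<notin> S"
    proof -
      have "a \<noteq> b" "a \<in> {1..d}" using a b S(1) by auto
      thus "(min a b, max a b) \<in> arcs d" using b(1) by (auto simp: arcs_def min_def max_def)
      show "min a b \<in> S \<longleftrightarrow> max a b \<notin> S" using a b(2) by (auto simp: min_def max_def)
    qed
    then obtain f where f: "f \<in> \<sigma>" "fst f \<in> S \<longleftrightarrow> snd f \<notin> S"
      using facet_crosses_cut[OF gen \<sigma>, of "(min a b, max a b)" S] by auto
    define x where "x = (if fst f \<in> S then snd f else fst f)"
    have x: "x \<notin> S" "x \<in> {1..d}" using f sub by (auto simp: x_def arcs_def)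
    let ?E = "\<lambda>S. {f \<in> \<sigma>. fst f \<in> S \<and> snd f \<in> S}"
    have "insert f (?E S) \<subseteq> ?E (insert x S)" using f by (auto simp: x_def)
    hence "card (insert f (?E S)) \<le> card (?E (insert x S))" using fin by (intro card_mono) auto
    moreover have "card (insert f (?E S)) = Suc (card (?E S))" using f fin by auto
    ultimately show ?case
      using S x finS by (intro exI[of _ "insert x S"]) auto
  qed
  from this[of "d - 1"] False obtain S where "d - 1 \<le> card {f \<in> \<sigma>. fst f \<in> S \<and> snd f \<in> S}" by auto
  also have "\<dots> \<le> card \<sigma>" using fin by (intro card_mono) auto
  finally show ?thesis .
qed simp

section \<open>The initial ideal and its standard pairs\<close>

lemma carrier_mpoly_ring: "carrier (mpoly_ring V) = {p. keys p \<subseteq> expos V}"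
  by (simp add: mpoly_ring_def)

lemma ideal_mpoly_ringI:
  fixes I :: "('v, 'k::field) mpoly set"
  assumes "I \<subseteq> carrier (mpoly_ring V)" "0 \<in> I"
    "\<And>p q. p \<in> I \<Longrightarrow> q \<in> I \<Longrightarrow> p + q \<in> I"
    "\<And>p q. p \<in> I \<Longrightarrow> q \<in> carrier (mpoly_ring V) \<Longrightarrow> q * p \<in> I"
  shows "ideal I (mpoly_ring V)"
proof -
  interpret cring "mpoly_ring V :: ('v, 'k) mpoly ring" by (rule cring_mpoly_ring)
  have minus_one: "(- 1 :: ('v, 'k) mpoly) \<in> carrier (mpoly_ring V)"
    by (simp add: carrier_mpoly_ring expos_def)
  have uminus: "- p \<in> I" if "p \<in> I" for p
    using assms(4)[OF that minus_one] by simp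
  have inv: "inv\<^bsub>add_monoid (mpoly_ring V)\<^esub> p = - p" if "p \<in> carrier (mpoly_ring V)" for p :: "('v, 'k) mpoly"
  proof -
    have "- p \<oplus>\<^bsub>mpoly_ring V\<^esub> p = \<zero>\<^bsub>mpoly_ring V\<^esub>" "- p \<in> carrier (mpoly_ring V)"
      using that by (simp_all add: mpoly_ring_def)
    from minus_equality[OF this(1) that this(2)] show ?thesis by (simp add: a_inv_def)
  qed
  show ?thesis
  proof (rule idealI)
    show "ring (mpoly_ring V :: ('v, 'k) mpoly ring)" by (rule ring_axioms)
    show "subgroup I (add_monoid (mpoly_ring V))"
    proof (rule subgroup.intro)
      show "I \<subseteq> carrier (add_monoid (mpoly_ring V))" using assms(1) by simp
      show "x \<otimes>\<^bsub>add_monoid (mpoly_ring V)\<^esub> y \<in> I" if "x \<in> I" "y \<in> I" for x y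
        using assms(3)[OF that] by (simp add: mpoly_ring_def)
      show "\<one>\<^bsub>add_monoid (mpoly_ring V)\<^esub> \<in> I" using assms(2) by (simp add: mpoly_ring_def)
      show "inv\<^bsub>add_monoid (mpoly_ring V)\<^esub> x \<in> I" if "x \<in> I" for x
        using that uminus inv[of x] assms(1) by auto
    qed
    show "x \<otimes>\<^bsub>mpoly_ring V\<^esub> p \<in> I" if "p \<in> I" "x \<in> carrier (mpoly_ring V)" for p x
      using assms(4)[OF that] by (simp add: mpoly_ring_def)
    show "p \<otimes>\<^bsub>mpoly_ring V\<^esub> x \<in> I" if "p \<in> I" "x \<in> carrier (mpoly_ring V)" for p x
      using assms(4)[OF that] by (simp add: mpoly_ring_def mult.commute)
  qed
qed

text \<open>
  Pairing a polynomial with an arbitrary function \<open>h\<close> of the degree \<open>A u\<close>: all these pairings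
  vanish iff in every fibre the coefficients sum to zero.
\<close>

definition fibre_pairing :: "nat \<Rightarrow> ((nat \<Rightarrow> int) \<Rightarrow> 'k) \<Rightarrow> (arc, 'k::field) mpoly \<Rightarrow> 'k" where
  "fibre_pairing d h f = (\<Sum>u\<in>keys f. lookup f u * h (incidence_mult d u))"

lemma fibre_pairing_superset:
  "finite S \<Longrightarrow> keys f \<subseteq> S \<Longrightarrow> fibre_pairing d h f = (\<Sum>u\<in>S. lookup f u * h (incidence_mult d u))"
  unfolding fibre_pairing_def by (intro sum.mono_neutral_left) (auto simp: in_keys_iff)

lemma fibre_pairing_add: "fibre_pairing d h (f + g) = fibre_pairing d h f + fibre_pairing d h g"
  using fibre_pairing_superset[of "keys f \<union> keys g" f d h]
    fibre_pairing_superset[of "keys f \<union> keys g" g d h]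
    fibre_pairing_superset[of "keys f \<union> keys g" "f + g" d h] Poly_Mapping.keys_add[of f g]
  by (simp add: lookup_add sum.distrib algebra_simps)

lemma fibre_pairing_zero [simp]: "fibre_pairing d h 0 = 0"
  by (simp add: fibre_pairing_def)

lemma fibre_pairing_sum: "fibre_pairing d h (\<Sum>i\<in>I. f i) = (\<Sum>i\<in>I. fibre_pairing d h (f i))"
  by (induction I rule: infinite_finite_induct) (simp_all add: fibre_pairing_add)

lemma fibre_pairing_single:
  "fibre_pairing d h (Poly_Mapping.single u a) = a * h (incidence_mult d u)"
  by (simp add: fibre_pairing_def)

lemma sum_of_terms:
  fixes p :: "'a \<Rightarrow>\<^sub>0 'b::comm_monoid_add"
  shows "(\<Sum>u\<in>keys p. Poly_Mapping.single u (lookup p u)) = p"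
  by (rule poly_mapping_eqI) (simp add: lookup_sum lookup_single when_def in_keys_iff)

text \<open>Multiplication by a monomial translates fibres and so replaces \<open>h\<close> by a
  translate. This is why \<open>h\<close> ranges over all functions: their common kernel is then
  closed under multiplication.\<close>

lemma fibre_pairing_mult:
  "fibre_pairing d h (p * f) =
     (\<Sum>u\<in>keys p. lookup p u *
        fibre_pairing d (\<lambda>b. h (\<lambda>v\<in>{1..d}. incidence_mult d u v + b v)) f)"
proof -
  have "p * f = (\<Sum>u\<in>keys p. Poly_Mapping.single u (lookup p u)) *
                (\<Sum>w\<in>keys f. Poly_Mapping.single w (lookup f w))"
    by (simp only: sum_of_terms)
  also have "\<dots> = (\<Sum>u\<in>keys p. \<Sum>w\<in>keys f. Poly_Mapping.single (u + w) (lookup p u * lookup f w))"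
    by (simp add: sum_product mult_single)
  finally show ?thesis
    by (simp add: fibre_pairing_sum fibre_pairing_single incidence_mult_plus)
       (simp add: fibre_pairing_def sum_distrib_left mult.assoc)
qed

lemma fibre_pairing_toric_ideal:
  assumes "f \<in> (toric_ideal d :: (arc, 'k::field) mpoly set)"
  shows "f \<in> carrier (mpoly_ring (arcs d))" "fibre_pairing d h f = 0"
proof -
  let ?K = "{f \<in> carrier (mpoly_ring (arcs d)). \<forall>h. fibre_pairing d h (f :: (arc, 'k) mpoly) = 0}"
  let ?R = "mpoly_ring (arcs d) :: (arc, 'k) mpoly ring"
  interpret cring ?R by (rule cring_mpoly_ring)
  have "ideal ?K ?R"
  proof (rule ideal_mpoly_ringI)
    show "p + q \<in> ?K" if "p \<in> ?K" "q \<in> ?K" for p q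
      using that Poly_Mapping.keys_add[of p q] by (auto simp: carrier_mpoly_ring fibre_pairing_add)
    show "q * p \<in> ?K" if "p \<in> ?K" "q \<in> carrier ?R" for p q
      using that m_closed[of q p] by (auto simp: fibre_pairing_mult mpoly_ring_def)
  qed (auto simp: carrier_mpoly_ring)
  moreover have "{xpow u - xpow v | u v. u \<in> expos (arcs d) \<and> v \<in> expos (arcs d) \<and>
        incidence_mult d u = incidence_mult d v} \<subseteq> ?K"
  proof clarsimp
    fix u v assume *: "u \<in> expos (arcs d)" "v \<in> expos (arcs d)" "incidence_mult d u = incidence_mult d v"
    have "xpow u - xpow v = Poly_Mapping.single u 1 + Poly_Mapping.single v (- 1 :: 'k)"
      by (simp add: xpow_def single_uminus)
    moreover have "keys (xpow u - xpow v :: (arc, 'k) mpoly) \<subseteq> {u, v}"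
      by (auto simp: xpow_def in_keys_iff lookup_minus lookup_single when_def split: if_splits)
    ultimately show "xpow u - xpow v \<in> carrier ?R \<and> (\<forall>h. fibre_pairing d h (xpow u - xpow v :: (arc, 'k) mpoly) = 0)"
      using * by (auto simp: carrier_mpoly_ring fibre_pairing_add fibre_pairing_single)
  qed
  ultimately have "toric_ideal d \<subseteq> ?K"
    unfolding toric_ideal_def by (rule genideal_minimal)
  thus "f \<in> carrier (mpoly_ring (arcs d))" "fibre_pairing d h f = 0" using assms by auto
qed

text \<open>If \<open>u\<close> were alone in its fibre, pairing with the indicator of that fibre
  would return the nonzero coefficient of \<open>u\<close>.\<close>

lemma toric_ideal_nonunique_fibre:
  fixes f :: "(arc, 'k::field) mpoly"
  assumes "f \<in> toric_ideal d" "u \<in> keys f"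
  obtains w where "w \<in> keys f" "w \<noteq> u" "incidence_mult d w = incidence_mult d u"
proof -
  have "\<exists>w\<in>keys f. w \<noteq> u \<and> incidence_mult d w = incidence_mult d u"
  proof (rule ccontr)
    assume "\<not> ?thesis"
    hence "fibre_pairing d (\<lambda>b. if b = incidence_mult d u then 1 else 0) f =
        (\<Sum>w\<in>keys f. if w = u then lookup f w else 0)"
      unfolding fibre_pairing_def by (intro sum.cong) auto
    thus False using fibre_pairing_toric_ideal(2)[OF assms(1)] assms(2) by auto
  qed
  thus thesis using that by blast
qed

lemma keys_initial_form:
  "keys (initial_form c f) \<subseteq> {u \<in> keys f. \<forall>v\<in>keys f. cost c v \<le> cost c u}"
proof -
  let ?M = "{u \<in> keys f. \<forall>v\<in>keys f. cost c v \<le> cost c u}"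
  have "lookup (initial_form c f) u = (if u \<in> ?M then lookup f u else 0)" for u
    unfolding initial_form_def lookup_sum lookup_single when_def by (subst sum.delta) auto
  thus ?thesis by (auto simp: in_keys_iff split: if_splits)
qed

lemma optimal_add_left:
  assumes "optimal d c (u + w)" "w \<in> expos (arcs d)"
  shows "optimal d c u"
  unfolding optimal_def
proof (intro conjI ballI impI)
  show "u \<in> expos (arcs d)" using assms(1) by (auto simp: optimal_def expos_def keys_plus_expo)
  fix v assume v: "v \<in> expos (arcs d)" "incidence_mult d v = incidence_mult d u" "v \<noteq> u"
  have "cost c (u + w) < cost c (v + w)"
    using assms v expos_plus[of v "arcs d" w]
    unfolding optimal_def by (auto simp: incidence_mult_plus intro: add_right_imp_eq)
  thus "cost c u < cost c v" by (simp add: cost_plus)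
qed

text \<open>Polynomials without optimal exponents form an ideal. It contains all initial forms,
  since an optimal exponent shares its fibre with another term of \<open>f\<close>, which costs
  more. Conversely, if \<open>w\<close> is the optimum in the fibre of a non-optimal
  \<open>u\<close>, then \<open>xpow u\<close> is the initial form of
  \<open>xpow u - xpow w\<close>.\<close>

lemma xpow_in_initial_ideal_iff:
  assumes gen: "generic_cost d c" and u: "u \<in> expos (arcs d)"
  shows "xpow u \<in> initial_ideal (arcs d) c (toric_ideal d :: (arc, 'k::field) mpoly set) \<longleftrightarrow>
           \<not> optimal d c u"
proof -
  let ?R = "mpoly_ring (arcs d) :: (arc, 'k) mpoly ring"
  let ?K = "{f \<in> carrier ?R. \<forall>u\<in>keys f. \<not> optimal d c u}"
  let ?I = "toric_ideal d :: (arc, 'k) mpoly set"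
  interpret cring ?R by (rule cring_mpoly_ring)
  have "ideal ?K ?R"
  proof (rule ideal_mpoly_ringI)
    show "p + q \<in> ?K" if "p \<in> ?K" "q \<in> ?K" for p q
      using that Poly_Mapping.keys_add[of p q] by (auto simp: carrier_mpoly_ring)
    show "q * p \<in> ?K" if p: "p \<in> ?K" and q: "q \<in> carrier ?R" for p q
    proof -
      have "\<not> optimal d c u" if u: "u \<in> keys (q * p)" for u
      proof -
        obtain a b where ab: "a \<in> keys q" "b \<in> keys p" "u = a + b"
          using u keys_mult[of q p] by blast
        have "a \<in> expos (arcs d)" using ab(1) q by (auto simp: carrier_mpoly_ring)
        thus ?thesis using optimal_add_left[of d c b a] ab p by (auto simp: add.commute)
      qed
      thus ?thesis using p q m_closed[of q p] by (simp add: mpoly_ring_def)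
    qed
  qed (auto simp: carrier_mpoly_ring)
  moreover have init: "initial_form c f \<in> ?K" if f: "f \<in> ?I" for f
  proof -
    have "\<not> optimal d c u" if "u \<in> keys (initial_form c f)" for u
    proof
      assume opt: "optimal d c u"
      have u: "u \<in> keys f" "\<And>v. v \<in> keys f \<Longrightarrow> cost c v \<le> cost c u"
        using that keys_initial_form[of c f] by auto
      obtain w where w: "w \<in> keys f" "w \<noteq> u" "incidence_mult d w = incidence_mult d u"
        using toric_ideal_nonunique_fibre[OF f u(1)] by blast
      have "w \<in> expos (arcs d)"
        using w(1) fibre_pairing_toric_ideal(1)[OF f] by (auto simp: carrier_mpoly_ring)
      thus False using opt w u(2)[OF w(1)] by (force simp: optimal_def)
    qed
    thus ?thesis using keys_initial_form[of c f] fibre_pairing_toric_ideal(1)[OF f]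
      by (auto simp: carrier_mpoly_ring)
  qed
  ultimately have sub: "initial_ideal (arcs d) c ?I \<subseteq> ?K"
    unfolding initial_ideal_def by (intro genideal_minimal) auto
  show ?thesis
  proof
    assume "xpow u \<in> initial_ideal (arcs d) c ?I"
    thus "\<not> optimal d c u" using sub by (auto simp: xpow_def)
  next
    assume nopt: "\<not> optimal d c u"
    from generic_obtain_optimal[OF gen u] obtain w
      where w: "optimal d c w" "incidence_mult d w = incidence_mult d u" .
    have ne: "w \<noteq> u" using nopt w by auto
    have less: "cost c w < cost c u" using w u ne by (auto simp: optimal_def)
    have wV: "w \<in> expos (arcs d)" using w by (simp add: optimal_def)
    let ?f = "xpow u - xpow w :: (arc, 'k) mpoly"
    have "keys ?f = {u, w}" using ne
      by (auto simp: xpow_def in_keys_iff lookup_minus lookup_single when_def split: if_splits)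
    hence "{v \<in> keys ?f. \<forall>x\<in>keys ?f. cost c x \<le> cost c v} = {u}"
      using less by auto
    hence "initial_form c ?f = xpow u"
      using ne by (simp add: initial_form_def xpow_def lookup_minus lookup_single when_def)
    moreover have "?f \<in> ?I"
      unfolding toric_ideal_def
    proof (rule subsetD[OF genideal_self])
      show "{xpow u - xpow v | u v. u \<in> expos (arcs d) \<and> v \<in> expos (arcs d) \<and>
        incidence_mult d u = incidence_mult d v} \<subseteq> carrier ?R"
      proof clarify
        fix u v :: "arc expo" assume uv: "u \<in> expos (arcs d)" "v \<in> expos (arcs d)"
        have "keys (xpow u - xpow v :: (arc, 'k) mpoly) \<subseteq> {u, v}"
          by (auto simp: xpow_def in_keys_iff lookup_minus lookup_single when_def split: if_splits)
        thus "xpow u - xpow v \<in> carrier ?R" using uv by (auto simp: carrier_mpoly_ring)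
      qed
      show "?f \<in> {xpow u - xpow v | u v. u \<in> expos (arcs d) \<and> v \<in> expos (arcs d) \<and>
        incidence_mult d u = incidence_mult d v}"
        using u wV w(2) by (intro CollectI exI[of _ u] exI[of _ w]) simp
    qed
    ultimately have "xpow u \<in> initial_form c ` ?I" by (metis image_eqI)
    moreover have "initial_form c ` ?I \<subseteq> carrier ?R" using init by blast
    ultimately show "xpow u \<in> initial_ideal (arcs d) c ?I"
      unfolding initial_ideal_def using genideal_self by blast
  qed
qed

text \<open>Optimality depends on the support alone, so the single test vector
  \<open>w = ind \<sigma>\<close> decides the condition for all \<open>w\<close> supported on
  \<open>\<sigma>\<close>.\<close>

lemma admissible_pair_initial_ideal_iff:
  assumes gen: "generic_cost d c"
  shows "admissible_pair (arcs d) (initial_ideal (arcs d) c (toric_ideal d :: (arc, 'k::field) mpoly set)) a \<sigma> \<longleftrightarrow>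
     keys a \<inter> \<sigma> = {} \<and> face d c (keys a \<union> \<sigma>)" (is "?L \<longleftrightarrow> ?R")
proof -
  let ?J = "initial_ideal (arcs d) c (toric_ideal d :: (arc, 'k) mpoly set)"
  have mono: "xpow a * xpow w \<notin> ?J \<longleftrightarrow> optimal d c (a + w)"
    if "a \<in> expos (arcs d)" "\<sigma> \<subseteq> arcs d" "keys w \<subseteq> \<sigma>" for w
  proof -
    have "w \<in> expos (arcs d)" using that by (auto simp: expos_def)
    hence "a + w \<in> expos (arcs d)" using that by (intro expos_plus)
    from xpow_in_initial_ideal_iff[OF gen this, where ?'k = 'k] show ?thesis
      by (simp add: xpow_def mult_single)
  qed
  show ?thesis
  proof
    assume L: ?L
    hence sub: "a \<in> expos (arcs d)" "\<sigma> \<subseteq> arcs d" by (auto simp: admissible_pair_def)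
    have k: "keys (ind \<sigma>) = \<sigma>" using finite_subset_arcs[OF sub(2)] by (rule keys_ind)
    hence "optimal d c (a + ind \<sigma>)"
      using L mono[OF sub, of "ind \<sigma>"] by (auto simp: admissible_pair_def)
    thus ?R using L by (simp add: optimal_iff_face[OF gen] keys_plus_expo k admissible_pair_def)
  next
    assume R: ?R
    hence sub: "a \<in> expos (arcs d)" "\<sigma> \<subseteq> arcs d" by (auto simp: face_def expos_def)
    have "optimal d c (a + w)" if "keys w \<subseteq> \<sigma>" for w
    proof (rule optimal_mono_support[OF gen])
      show "optimal d c (ind (keys a \<union> \<sigma>))" using R by (simp add: face_def)
      show "keys (a + w) \<subseteq> keys (ind (keys a \<union> \<sigma>))"
        using that R by (subst keys_ind) (auto simp: face_def keys_plus_expo dest: finite_subset_arcs)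
    qed
    thus ?L using R sub mono[OF sub] by (simp add: admissible_pair_def)
  qed
qed

text \<open>An admissible pair \<open>(a, \<sigma>)\<close> is dominated by
  \<open>(0, keys a \<union> \<sigma>)\<close>, which forces \<open>a = 0\<close>; what remains is
  maximality of \<open>\<sigma>\<close>.\<close>

lemma standard_pair_initial_ideal_iff:
  assumes gen: "generic_cost d c"
  shows "standard_pair (arcs d) (initial_ideal (arcs d) c (toric_ideal d :: (arc, 'k::field) mpoly set)) a \<sigma> \<longleftrightarrow>
     a = 0 \<and> \<sigma> \<in> facets d c"
proof (intro iffI conjI)
  note adm = admissible_pair_initial_ideal_iff[OF gen, where ?'k = 'k]
  let ?J = "initial_ideal (arcs d) c (toric_ideal d :: (arc, 'k) mpoly set)"
  assume std: "standard_pair (arcs d) ?J a \<sigma>"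
  hence a: "keys a \<inter> \<sigma> = {}" "face d c (keys a \<union> \<sigma>)"
    unfolding standard_pair_def adm by blast+
  have best: "keys a' \<inter> \<sigma>' = {} \<Longrightarrow> face d c (keys a' \<union> \<sigma>') \<Longrightarrow> a = a' + b \<Longrightarrow>
           keys b \<union> \<sigma> \<subseteq> \<sigma>' \<Longrightarrow> (a', \<sigma>') = (a, \<sigma>)" for a' \<sigma>' b
    using std unfolding standard_pair_def adm by blast
  have "(0, keys a \<union> \<sigma>) = (a, \<sigma>)" using a by (intro best[of _ _ a]) auto
  thus 0: "a = 0" by simp
  have "\<tau> = \<sigma>" if "face d c \<tau>" "\<sigma> \<subseteq> \<tau>" for \<tau>
    using best[of 0 \<tau> 0] that 0 by auto
  thus "\<sigma> \<in> facets d c" using a 0 by (simp add: facets_def)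
next
  note adm = admissible_pair_initial_ideal_iff[OF gen, where ?'k = 'k]
  let ?J = "initial_ideal (arcs d) c (toric_ideal d :: (arc, 'k) mpoly set)"
  assume *: "a = 0 \<and> \<sigma> \<in> facets d c"
  have "a' = 0" if "0 = a' + b" for a' b :: "arc expo"
    using that keys_plus_expo[of a' b] by (metis Un_empty keys_eq_empty keys_zero)
  thus "standard_pair (arcs d) ?J a \<sigma>"
    using * unfolding standard_pair_def adm facets_def by auto
qed

lemma arithmetic_degree_initial_ideal:
  assumes gen: "generic_cost d c"
  shows "arithmetic_degree (arcs d) (initial_ideal (arcs d) c (toric_ideal d :: (arc, 'k::field) mpoly set)) =
     enat (card (facets d c))"
proof -
  have "{(a, \<sigma>). standard_pair (arcs d) (initial_ideal (arcs d) c (toric_ideal d :: (arc, 'k) mpoly set)) a \<sigma>} =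
        Pair 0 ` facets d c"
    by (auto simp: standard_pair_initial_ideal_iff[OF gen])
  thus ?thesis
    by (simp add: arithmetic_degree_def card_image inj_on_def)
qed

section \<open>A cost vector with the noncrossing alternating trees as facets\<close>

text \<open>Strictly concave in the arc length: replacing \<open>(i, j)\<close> and
  \<open>(k, l)\<close> with \<open>i < k \<le> j < l\<close> by the nested \<open>(i, l)\<close>
  and \<open>(k, j)\<close> keeps the total length and lowers the cost. For \<open>k = j\<close> the
  second arc has length and cost 0, so directed paths are covered as well.\<close>

definition neg_sq_cost :: "arc \<Rightarrow> real" where
  "neg_sq_cost e = - ((real (snd e) - real (fst e))\<^sup>2)"

lemma diff_single_plus_single:
  assumes "e \<in> keys (u :: 'v expo)"
  shows "u - Poly_Mapping.single e (Suc 0) + Poly_Mapping.single e (Suc 0) = u"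
proof -
  have "lookup u e \<ge> Suc 0" using assms in_keys_iff[of e u] by simp
  thus ?thesis
    by (intro poly_mapping_eqI) (auto simp: lookup_add lookup_minus lookup_single when_def)
qed

lemma cost_single [simp]: "cost c (Poly_Mapping.single e (Suc 0)) = c e"
  by (simp add: cost_def)

lemma incidence_mult_eqI:
  "(\<And>v. v \<in> {1..d} \<Longrightarrow> incidence_mult d u v = incidence_mult d w v) \<Longrightarrow> incidence_mult d u = incidence_mult d w"
  by (rule ext) (simp add: incidence_mult_def)

lemma incidence_mult_single:
  "e \<in> arcs d \<Longrightarrow> v \<in> {1..d} \<Longrightarrow> incidence_mult d (Poly_Mapping.single e (Suc 0)) v = incidence v e"
  by (simp add: incidence_mult_def lookup_single when_def if_distrib[of int] if_distrib[of "(*) _"] sum.delta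
      cong: if_cong)

lemma incidence_mult_eq_balance:
  "v \<in> {1..d} \<Longrightarrow> incidence_mult d u v = balance d (\<lambda>e. int (lookup u e)) v"
  by (simp add: incidence_mult_def balance_def)

lemma sum_potential_incidence_mult:
  "(\<Sum>v\<in>{1..d}. \<phi> v * incidence_mult d u v) = (\<Sum>e\<in>arcs d. (\<phi> (fst e) - \<phi> (snd e)) * int (lookup u e))"
  by (subst sum_potential_balance[symmetric]) (simp add: incidence_mult_eq_balance)

lemma deg_expos: "u \<in> expos (arcs d) \<Longrightarrow> deg u = (\<Sum>e\<in>arcs d. lookup u e)"
  by (rule deg_superset) (auto simp: expos_def)

text \<open>Acyclicity enters here: the potential \<open>- int v\<close> weights the arc
  \<open>(i, j)\<close> by \<open>j - i\<close>, at least 1, and so bounds the total degree. The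
  costs in \<open>neg_sq_cost\<close> are negative, so existence of a minimum rests on this.\<close>

lemma finite_fibre: "finite {w \<in> expos (arcs d). incidence_mult d w = b}"
proof (rule finite_subset)
  let ?m = "nat (\<Sum>v\<in>{1..d}. - int v * b v)"
  show "finite (box (arcs d) ?m)" using finite_card_box[of "arcs d"] by simp
  have "deg w \<le> ?m" if "w \<in> expos (arcs d)" "incidence_mult d w = b" for w
  proof -
    have "int (deg w) = (\<Sum>e\<in>arcs d. int (lookup w e))" using that by (simp add: deg_expos)
    also have "\<dots> \<le> (\<Sum>e\<in>arcs d. (- int (fst e) - - int (snd e)) * int (lookup w e))"
    proof (rule sum_mono)
      fix e assume "e \<in> arcs d"
      hence "1 \<le> - int (fst e) - - int (snd e)" by (auto simp: arcs_def)
      from mult_right_mono[OF this, of "int (lookup w e)"]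
      show "int (lookup w e) \<le> (- int (fst e) - - int (snd e)) * int (lookup w e)" by simp
    qed
    also have "\<dots> = (\<Sum>v\<in>{1..d}. - int v * b v)"
      using sum_potential_incidence_mult[of "\<lambda>v. - int v" d w] that by simp
    finally show ?thesis by linarith
  qed
  thus "{w \<in> expos (arcs d). incidence_mult d w = b} \<subseteq> box (arcs d) ?m"
    by (auto simp: box_def expos_def)
qed

text \<open>Ties are allowed in the hypothesis because the lemma serves to establish genericity,
  before the minimum is known to be unique.\<close>

lemma neg_sq_cost_optimum_nca:
  assumes u: "u \<in> expos (arcs d)"
    and min: "\<And>w. w \<in> expos (arcs d) \<Longrightarrow> incidence_mult d w = incidence_mult d u \<Longrightarrow>
                cost neg_sq_cost u \<le> cost neg_sq_cost w"
  shows "nca (keys u)"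
  unfolding nca_def
proof (clarify)
  fix i j k l assume ij: "(i, j) \<in> keys u" and kl: "(k, l) \<in> keys u" and lt: "i < k" "k \<le> j" "j < l"
  let ?e = "\<lambda>x y :: nat. Poly_Mapping.single (x, y) (Suc 0)"
  have V: "(i, j) \<in> arcs d" "(k, l) \<in> arcs d" using ij kl u by (auto simp: expos_def)
  hence V': "(i, l) \<in> arcs d" "k < j \<Longrightarrow> (k, j) \<in> arcs d" using lt by (auto simp: arcs_def)
  define r where "r = u - ?e i j - ?e k l"
  define s where "s = (if k < j then ?e k j else 0)"
  have "(i, j) \<noteq> (k, l)" using lt by simp
  hence u_eq: "u = r + ?e i j + ?e k l"
  proof -
    have "(k, l) \<in> keys (u - ?e i j)"
      using kl \<open>(i, j) \<noteq> (k, l)\<close> by (simp add: in_keys_iff lookup_minus lookup_single)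
    from diff_single_plus_single[OF this] diff_single_plus_single[OF ij]
    show ?thesis by (simp add: r_def add_ac)
  qed
  have rV: "r \<in> expos (arcs d)" using u unfolding u_eq by (simp add: expos_def keys_plus_expo)
  define w where "w = r + ?e i l + s"
  have "w \<in> expos (arcs d)" using rV V' by (auto simp: w_def s_def expos_def keys_plus_expo)
  moreover have "incidence_mult d w = incidence_mult d u"
  proof (rule incidence_mult_eqI)
    fix v assume v: "v \<in> {1..d}"
    have "incidence_mult d s v = (if k < j then incidence v (k, j) else 0)"
    proof (cases "k < j")
      case False
      thus ?thesis using v by (simp add: s_def incidence_mult_def)
    qed (use v V' in \<open>simp add: s_def incidence_mult_single\<close>)
    thus "incidence_mult d w v = incidence_mult d u v"
      unfolding w_def u_eq using v V V' lt
      by (auto simp: incidence_mult_plus incidence_mult_single incidence_def)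
  qed
  ultimately have "cost neg_sq_cost u \<le> cost neg_sq_cost w" by (rule min)
  moreover have "cost neg_sq_cost s = neg_sq_cost (k, j)"
    using lt by (auto simp: s_def neg_sq_cost_def cost_def)
  ultimately have "neg_sq_cost (i, j) + neg_sq_cost (k, l) \<le> neg_sq_cost (i, l) + neg_sq_cost (k, j)"
    unfolding w_def by (subst (asm) u_eq) (simp add: cost_plus)
  hence "2 * ((real k - real i) * (real l - real j)) \<le> 0"
    by (simp add: neg_sq_cost_def power2_eq_square algebra_simps)
  moreover have "(real k - real i) * (real l - real j) > 0" using lt by simp
  ultimately show False by linarith
qed

text \<open>By alternation no vertex is both a tail and a head, so the terms of the sum at
  \<open>v\<close> have one sign and cannot cancel.\<close>

lemma nca_tails:
  assumes u: "u \<in> expos (arcs d)" "nca (keys u)" and v: "v \<in> {1..d}"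
  shows "incidence_mult d u v > 0 \<longleftrightarrow> (\<exists>j. (v, j) \<in> keys u)"
    and "incidence_mult d u v < 0 \<longleftrightarrow> (\<exists>i. (i, v) \<in> keys u)"
proof -
  have arc: "(i, j) \<in> arcs d" if "(i, j) \<in> keys u" for i j using u(1) that by (auto simp: expos_def)
  have alt: "\<not> ((i, v) \<in> keys u \<and> (v, j) \<in> keys u)" for i j
    using u(2) arc[of i v] arc[of v j] by (fastforce simp: nca_def arcs_def)
  have b: "incidence_mult d u v = (\<Sum>e\<in>arcs d. incidence v e * int (lookup u e))"
    using v by (simp add: incidence_mult_def)
  have pos: "incidence_mult d u v > 0" if vj: "(v, j) \<in> keys u" for j
    unfolding b
  proof (rule sum_pos2[of _ "(v, j)"])
    show "0 \<le> incidence v e * int (lookup u e)" for e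
      using alt[of "fst e" j] vj by (cases e) (auto simp: incidence_def in_keys_iff)
    show "0 < incidence v (v, j) * int (lookup u (v, j))"
      using vj by (simp add: incidence_def in_keys_iff)
  qed (use arc vj in auto)
  have "0 < (\<Sum>e\<in>arcs d. - (incidence v e * int (lookup u e)))" if iv: "(i, v) \<in> keys u" for i
  proof (rule sum_pos2[of _ "(i, v)"])
    show "0 \<le> - (incidence v e * int (lookup u e))" for e
      using alt[of i "snd e"] iv by (cases e) (auto simp: incidence_def in_keys_iff)
    show "0 < - (incidence v (i, v) * int (lookup u (i, v)))"
      using iv arc[OF iv] by (simp add: incidence_def in_keys_iff arcs_def)
  qed (use arc iv in auto)
  hence neg: "incidence_mult d u v < 0" if "(i, v) \<in> keys u" for i
    using that by (simp add: b sum_negf)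
  have "incidence_mult d u v \<le> 0" if "\<nexists>j. (v, j) \<in> keys u"
    unfolding b using that by (intro sum_nonpos) (auto simp: incidence_def in_keys_iff)
  thus "incidence_mult d u v > 0 \<longleftrightarrow> (\<exists>j. (v, j) \<in> keys u)" using pos by force
  have "incidence_mult d u v \<ge> 0" if "\<nexists>i. (i, v) \<in> keys u"
    unfolding b using that by (intro sum_nonneg) (auto simp: incidence_def in_keys_iff)
  thus "incidence_mult d u v < 0 \<longleftrightarrow> (\<exists>i. (i, v) \<in> keys u)" using neg by force
qed

text \<open>
  The first sink \<open>k\<close> and the last source \<open>j\<close> before it are determined by the degree and must be
  joined by an arc.
\<close>

lemma nca_common_arc:
  assumes u: "u \<in> expos (arcs d)" "nca (keys u)" and w: "w \<in> expos (arcs d)" "nca (keys w)"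
    and eq: "incidence_mult d u = incidence_mult d w" and "u \<noteq> 0"
  obtains e where "e \<in> keys u" "e \<in> keys w"
proof -
  define P where "P = {v \<in> {1..d}. incidence_mult d u v > 0}"
  define N where "N = {v \<in> {1..d}. incidence_mult d u v < 0}"
  define k where "k = Min N"
  define j where "j = Max {v \<in> P. v < k}"
  have fin: "finite P" "finite N" by (auto simp: P_def N_def)
  \<comment> \<open>Both \<open>j\<close> and \<open>k\<close> depend on the fibre only, so every
    \<open>nca\<close> vector in it contains the same arc.\<close>
  have arc: "(j, k) \<in> keys x"
    if x: "x \<in> expos (arcs d)" "nca (keys x)" and xu: "incidence_mult d x = incidence_mult d u" and "N \<noteq> {}" for x
  proof -
    have arcs: "a \<in> {1..d}" "b \<in> {1..d}" "a < b" if "(a, b) \<in> keys x" for a b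
      using x(1) that by (auto simp: expos_def arcs_def)
    have P: "v \<in> P \<longleftrightarrow> (\<exists>b. (v, b) \<in> keys x)" for v
      using nca_tails(1)[OF x, of v] xu arcs by (auto simp: P_def)
    have N: "v \<in> N \<longleftrightarrow> (\<exists>a. (a, v) \<in> keys x)" for v
      using nca_tails(2)[OF x, of v] xu arcs by (auto simp: N_def)
    have "k \<in> N" unfolding k_def using fin that by (intro Min_in)
    then obtain i where i: "(i, k) \<in> keys x" using N by blast
    hence iP: "i \<in> {v \<in> P. v < k}" using P arcs by auto
    hence "j \<in> {v \<in> P. v < k}" unfolding j_def using fin by (intro Max_in) auto
    then obtain l where l: "(j, l) \<in> keys x" "j < k" using P by auto
    have "i \<le> j" unfolding j_def using fin iP by (intro Max_ge) auto
    moreover have "k \<le> l" unfolding k_def using fin N l by (intro Min_le) auto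
    \<comment> \<open>Here \<open>i \<le> j < k \<le> l\<close>. If both outer inequalities were
      strict, \<open>(i, k)\<close> and \<open>(j, l)\<close> would cross, so one of them is already
      \<open>(j, k)\<close>.\<close>
    moreover have "\<not> (i < j \<and> k < l)" using x(2) i l by (fastforce simp: nca_def)
    ultimately show ?thesis using i l by (cases "i = j") auto
  qed
  obtain a b where ab: "(a, b) \<in> keys u" using \<open>u \<noteq> 0\<close> by (metis equals0I keys_eq_empty surj_pair)
  hence "b \<in> {1..d}" using u(1) by (auto simp: expos_def arcs_def)
  hence "b \<in> N" using nca_tails(2)[OF u] ab by (auto simp: N_def)
  hence "N \<noteq> {}" by blast
  thus thesis using arc[OF u] arc[OF w] eq that by auto
qed

text \<open>Two such vectors share an arc; removing it preserves \<open>nca\<close>, which passes to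
  subsets, and lowers the degree.\<close>

lemma nca_unique:
  "u \<in> expos (arcs d) \<Longrightarrow> nca (keys u) \<Longrightarrow> w \<in> expos (arcs d) \<Longrightarrow> nca (keys w) \<Longrightarrow>
     incidence_mult d u = incidence_mult d w \<Longrightarrow> u = w"
proof (induction "deg u" arbitrary: u w rule: less_induct)
  case less
  show ?case
  proof (cases "u = 0 \<and> w = 0")
    case False
    \<comment> \<open>Exchanging the roles covers \<open>u = 0\<close>, as
      \<open>nca_common_arc\<close> asks for its first vector to be nonzero.\<close>
    then obtain e where e: "e \<in> keys u" "e \<in> keys w"
      using nca_common_arc[of u d w] nca_common_arc[of w d u] less.prems by metis
    let ?s = "Poly_Mapping.single e (Suc 0)"
    define u' w' where "u' = u - ?s" and "w' = w - ?s"
    have u': "u = u' + ?s" and w': "w = w' + ?s"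
      using diff_single_plus_single[OF e(1)] diff_single_plus_single[OF e(2)] by (simp_all add: u'_def w'_def)
    have "u' = w'"
    proof (rule less.hyps)
      show "deg u' < deg u" by (subst u') (simp add: deg_plus)
      show "u' \<in> expos (arcs d)" "w' \<in> expos (arcs d)"
        using less.prems(1,3) u' w' by (auto simp: expos_def keys_plus_expo)
      show "nca (keys u')" "nca (keys w')"
        using nca_subset[OF less.prems(2), of "keys u'"] nca_subset[OF less.prems(4), of "keys w'"]
          arg_cong[OF u', of keys] arg_cong[OF w', of keys] by (auto simp: keys_plus_expo)
      show "incidence_mult d u' = incidence_mult d w'"
      proof (rule incidence_mult_eqI)
        fix v assume "v \<in> {1..d}"
        moreover have "incidence_mult d (u' + ?s) v = incidence_mult d (w' + ?s) v"
          using less.prems(5) u' w' by simp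
        ultimately show "incidence_mult d u' v = incidence_mult d w' v"
          by (simp add: incidence_mult_plus)
      qed
    qed
    thus ?thesis using u' w' by simp
  qed simp
qed

lemma generic_neg_sq_cost: "generic_cost d neg_sq_cost"
  unfolding generic_cost_def
proof
  fix b assume b: "b \<in> incidence_mult d ` expos (arcs d)"
  let ?F = "{w \<in> expos (arcs d). incidence_mult d w = b}"
  have "?F \<noteq> {}" using b by auto
  from ex_is_arg_min_if_finite[OF finite_fibre this]
  obtain x where x: "is_arg_min (cost neg_sq_cost) (\<lambda>x. x \<in> ?F) x" by blast
  have nca: "nca (keys x) \<and> x \<in> ?F" if "is_arg_min (cost neg_sq_cost) (\<lambda>x. x \<in> ?F) x" for x
    using that by (auto intro!: neg_sq_cost_optimum_nca simp: is_arg_min_linorder)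
  have "\<exists>!x. is_arg_min (cost neg_sq_cost) (\<lambda>x. x \<in> ?F) x"
  proof (rule ex1I, rule x)
    fix y assume "is_arg_min (cost neg_sq_cost) (\<lambda>x. x \<in> ?F) y"
    thus "y = x" using nca[OF x] nca[of y] by (auto intro: nca_unique)
  qed
  thus "\<exists>!x. is_arg_min (cost neg_sq_cost) (\<lambda>x. x \<in> expos (arcs d) \<and> incidence_mult d x = b) x"
    by simp
qed

lemma optimal_neg_sq_cost_iff:
  "optimal d neg_sq_cost u \<longleftrightarrow> u \<in> expos (arcs d) \<and> nca (keys u)"
proof -
  have *: "u \<in> expos (arcs d) \<and> nca (keys u)" if "optimal d neg_sq_cost u" for u
    using that by (auto simp: optimal_def intro!: neg_sq_cost_optimum_nca)
  moreover have "optimal d neg_sq_cost u" if u: "u \<in> expos (arcs d)" "nca (keys u)"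
  proof -
    from generic_obtain_optimal[OF generic_neg_sq_cost u(1)] obtain w
      where w: "optimal d neg_sq_cost w" "incidence_mult d w = incidence_mult d u" .
    hence "w = u" using * u by (blast intro: nca_unique)
    thus ?thesis using w by simp
  qed
  ultimately show ?thesis by blast
qed

lemma facets_neg_sq_cost:
  assumes "d \<ge> 1"
  shows "facets d neg_sq_cost = nct 1 (d - 1)"
proof -
  have "face d neg_sq_cost \<sigma> \<longleftrightarrow> \<sigma> \<subseteq> arcs d \<and> nca \<sigma>" for \<sigma>
    using keys_ind[OF finite_subset_arcs, of \<sigma> d]
    by (auto simp: face_def optimal_neg_sq_cost_iff expos_def)
  moreover have "arcs d = arcs_on 1 (1 + (d - 1))" using assms by (simp add: arcs_eq_arcs_on)
  ultimately show ?thesis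
    by (auto simp: facets_def maximal_nca_iff_nct)
qed

text \<open>Every arc of an alternating \<open>u\<close> leaves the set of sources, so no equivalent vector is shorter.\<close>

lemma nca_deg_minimal:
  assumes u: "u \<in> expos (arcs d)" "nca (keys u)"
    and w: "w \<in> expos (arcs d)" "incidence_mult d w = incidence_mult d u"
  shows "deg u \<le> deg w"
proof -
  define \<phi> where "\<phi> v = (of_bool (\<exists>j. (v, j) \<in> keys u) :: int)" for v
  have "(\<phi> (fst e) - \<phi> (snd e)) * int (lookup u e) = int (lookup u e)" if e: "e \<in> arcs d" for e
  proof (cases "e \<in> keys u")
    case True
    obtain i j where [simp]: "e = (i, j)" by (cases e)
    have "(j, l) \<notin> keys u" for l
    proof
      assume "(j, l) \<in> keys u"
      moreover from this have "j < l" using u(1) by (auto simp: expos_def arcs_def)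
      ultimately show False using u(2) True e by (fastforce simp: nca_def arcs_def)
    qed
    thus ?thesis using True by (auto simp: \<phi>_def)
  qed (simp add: in_keys_iff)
  hence "int (deg u) = (\<Sum>e\<in>arcs d. (\<phi> (fst e) - \<phi> (snd e)) * int (lookup u e))"
    unfolding deg_expos[OF u(1)] of_nat_sum by (intro sum.cong refl) simp
  also have "\<dots> = (\<Sum>e\<in>arcs d. (\<phi> (fst e) - \<phi> (snd e)) * int (lookup w e))"
    using sum_potential_incidence_mult[of \<phi> d u] sum_potential_incidence_mult[of \<phi> d w] w(2) by simp
  \<comment> \<open>For any vector an arc lowers the potential by at most 1; on the arcs of
    \<open>u\<close> it is exactly 1.\<close>
  also have "\<dots> \<le> (\<Sum>e\<in>arcs d. int (lookup w e))"
    by (intro sum_mono) (auto simp: \<phi>_def of_bool_def)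
  also have "\<dots> = int (deg w)" using w by (simp add: deg_expos)
  finally show ?thesis by simp
qed

section \<open>Comparing two triangulations by counting lattice points\<close>

lemma card_facets_le:
  assumes gen: "generic_cost d c" and d: "d \<ge> 1"
  shows "card (facets d c) \<le> catalan (d - 1)"
proof (rule le_of_choose_bound)
  fix m
  let ?r = "d - 1" and ?n = "card (arcs d)"
  \<comment> \<open>The shift by \<open>ind \<sigma>\<close> gives each element support exactly
    \<open>\<sigma>\<close>, so the pieces of \<open>X\<close> are disjoint; those of
    \<open>Y\<close> may overlap, as an upper bound permits. The slack \<open>?n\<close> pays for
    the degree \<open>card \<sigma>\<close> of the shift.\<close>
  define X where "X = (\<Union>\<sigma>\<in>facets d c. (\<lambda>u. u + ind \<sigma>) ` box \<sigma> m)"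
  define Y where "Y = (\<Union>T\<in>nct 1 ?r. box T (m + ?n))"
  have sub: "\<sigma> \<subseteq> arcs d" "finite \<sigma>" if "\<sigma> \<in> facets d c" for \<sigma>
    using that finite_subset_arcs by (auto simp: facets_def face_def)
  have elem: "keys x = \<sigma>" if "\<sigma> \<in> facets d c" "x \<in> (\<lambda>u. u + ind \<sigma>) ` box \<sigma> m" for x \<sigma>
    using that sub[of \<sigma>] by (auto simp: box_def keys_plus_expo keys_ind)
  have box: "finite (box \<sigma> k)" "card (box \<sigma> k) = (k + card \<sigma>) choose card \<sigma>" if "finite \<sigma>" for \<sigma> :: "arc set" and k
    using finite_card_box[OF that] by auto
  have nct: "T \<subseteq> arcs d" "finite T" "card T = ?r" if "T \<in> nct 1 ?r" for T
    using nct_subset[OF that] nct_card[OF that] d finite_subset[of T "arcs d"] by (auto simp: arcs_eq_arcs_on)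
  have "card (facets d c) * ((m + ?r) choose ?r) = (\<Sum>\<sigma>\<in>facets d c. (m + ?r) choose ?r)" by simp
  also have "\<dots> \<le> (\<Sum>\<sigma>\<in>facets d c. card ((\<lambda>u. u + ind \<sigma>) ` box \<sigma> m))"
  proof (rule sum_mono)
    fix \<sigma> assume \<sigma>: "\<sigma> \<in> facets d c"
    have "inj_on (\<lambda>u. u + ind \<sigma>) (box \<sigma> m)" by (rule inj_onI) (erule add_right_imp_eq)
    thus "(m + ?r) choose ?r \<le> card ((\<lambda>u. u + ind \<sigma>) ` box \<sigma> m)"
      using choose_add_mono[OF card_facet_ge[OF gen \<sigma>], of m] box(2)[OF sub(2)[OF \<sigma>], of m]
      by (simp add: card_image)
  qed
  also have "\<dots> = card X"
    unfolding X_def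
  proof (rule card_UN_disjoint[symmetric])
    show "\<forall>\<sigma>\<in>facets d c. finite ((\<lambda>u. u + ind \<sigma>) ` box \<sigma> m)" using box(1) sub by simp
    show "\<forall>\<sigma>\<in>facets d c. \<forall>\<tau>\<in>facets d c. \<sigma> \<noteq> \<tau> \<longrightarrow>
            (\<lambda>u. u + ind \<sigma>) ` box \<sigma> m \<inter> (\<lambda>u. u + ind \<tau>) ` box \<tau> m = {}"
      using elem by (metis disjoint_iff)
  qed simp
  \<comment> \<open>Elements of \<open>X\<close> are optimal for \<open>c\<close>, so distinct ones
    lie in distinct fibres. Passing to images under \<open>A\<close> is what allows the change of
    cost vector.\<close>
  also have "card X = card (incidence_mult d ` X)"
  proof (rule card_image[symmetric], rule inj_onI)
    fix x y assume "x \<in> X" "y \<in> X" "incidence_mult d x = incidence_mult d y"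
    moreover have "optimal d c x" if "x \<in> X" for x
      using that elem optimal_iff_face[OF gen, of x] by (auto simp: X_def facets_def)
    ultimately show "x = y" by (blast intro: optimal_unique)
  qed
  also have "\<dots> \<le> card (incidence_mult d ` Y)"
  proof (rule card_mono)
    show "finite (incidence_mult d ` Y)" using box(1) nct by (auto simp: Y_def)
    show "incidence_mult d ` X \<subseteq> incidence_mult d ` Y"
    proof clarify
      fix x assume "x \<in> X"
      then obtain \<sigma> u where x: "\<sigma> \<in> facets d c" "u \<in> box \<sigma> m" "x = u + ind \<sigma>" by (auto simp: X_def)
      have "keys x = \<sigma>" using elem x by blast
      hence xV: "x \<in> expos (arcs d)" using sub x by (simp add: expos_def)
      have "deg x \<le> m + card \<sigma>" using x sub by (simp add: deg_plus deg_ind box_def)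
      also have "\<dots> \<le> m + ?n" using sub x by (simp add: card_mono)
      finally have degx: "deg x \<le> m + ?n" .
      from generic_obtain_optimal[OF generic_neg_sq_cost xV] obtain w
        where w: "optimal d neg_sq_cost w" "incidence_mult d w = incidence_mult d x" .
      hence w': "w \<in> expos (arcs d)" "nca (keys w)" by (auto simp: optimal_neg_sq_cost_iff)
      \<comment> \<open>Minimal total degree carries the bound from \<open>x\<close> to its
        representative \<open>w\<close> in the other triangulation.\<close>
      hence "deg w \<le> m + ?n" using nca_deg_minimal[OF w' xV] w degx by simp
      moreover obtain T where "T \<in> nct 1 ?r" "keys w \<subseteq> T"
        using nca_extends_to_nct[OF w'(2), of 1 ?r] w'(1) d by (auto simp: expos_def arcs_eq_arcs_on)
      ultimately have "w \<in> Y" by (auto simp: Y_def box_def)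
      thus "incidence_mult d x \<in> incidence_mult d ` Y" using w(2) by (metis image_eqI)
    qed
  qed
  also have "\<dots> \<le> card Y" using box(1) nct by (intro card_image_le) (auto simp: Y_def)
  also have "\<dots> \<le> (\<Sum>T\<in>nct 1 ?r. card (box T (m + ?n)))" unfolding Y_def by (rule card_UN_le) simp
  also have "\<dots> = catalan ?r * ((m + ?n + ?r) choose ?r)"
    using box(2) nct by (simp add: card_nct)
  finally show "card (facets d c) * ((m + ?r) choose ?r) \<le> catalan ?r * ((m + ?n + ?r) choose ?r)" .
qed

theorem theorem4p15:
  fixes d :: nat
  assumes "d \<ge> 2"
  shows "(\<exists>c. generic_cost d c \<and>
            arithmetic_degree (arcs d)
              (initial_ideal (arcs d) c (toric_ideal d :: (arc, 'k::field) mpoly set))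
            = enat (catalan (d - 1))) \<and>
         (\<forall>c. generic_cost d c \<longrightarrow>
            arithmetic_degree (arcs d)
              (initial_ideal (arcs d) c (toric_ideal d :: (arc, 'k::field) mpoly set))
            \<le> enat (catalan (d - 1)))"
proof (intro conjI exI allI impI)
  show "generic_cost d neg_sq_cost" by (rule generic_neg_sq_cost)
  show "arithmetic_degree (arcs d)
      (initial_ideal (arcs d) neg_sq_cost (toric_ideal d :: (arc, 'k) mpoly set)) = enat (catalan (d - 1))"
    using assms by (simp add: arithmetic_degree_initial_ideal[OF generic_neg_sq_cost]
        facets_neg_sq_cost card_nct)
next
  fix c assume "generic_cost d c"
  thus "arithmetic_degree (arcs d)
      (initial_ideal (arcs d) c (toric_ideal d :: (arc, 'k) mpoly set)) \<le> enat (catalan (d - 1))"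
    using assms card_facets_le[of d c] by (simp add: arithmetic_degree_initial_ideal)
qed

end
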